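(* (i) There exists a universal numerical constant $C>0$ (independent of the dimension and of the measure) such that for every $d\ge 1$ and every centered, isotropic, log-concave probability measure $\mu$ on $\mathbb{R}^d$, the Brenier map $T$ sending the standard Gaussian measure $\gamma$ on $\mathbb{R}^d$ onto $\mu$ satisfies $$|T(x)| \leq C(d + |x|^2) \qquad \text{for every } x\in \mathbb{R}^d.$$ (ii) Let $d \ge 1$, $\beta>0$, and let $\mu$ be a centered probability measure on $\mathbb{R}^d$ (not assumed log-concave or isotropic) that satisfies the Gaussian concentration property with constant $\beta$. Then the Brenier map $T$ sending the standard Gaussian measure $\gamma$ on $\mathbb{R}^d$ onto $\mu$ satisfies $$|T(x)| \leq 12\,\beta^{-1/2}\sqrt{|x|^2 + 17d} \qquad \text{for every } x\in\mathbb{R}^d.$$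
   Context: $|\cdot|$ is the Euclidean norm on $\mathbb{R}^d$, and $\gamma$ is the standard Gaussian measure on $\mathbb{R}^d$. A probability measure is centered if its mean is $0$, and isotropic if its covariance matrix is the identity. The Brenier map sending $\gamma$ onto $\mu$ is the ($\gamma$-a.e. unique) map $T=\nabla\varphi$, with $\varphi:\mathbb{R}^d\to\mathbb{R}\cup\{+\infty\}$ convex, that pushes $\gamma$ forward to $\mu$; $T(x)$ is defined at the points $x$ where $\varphi$ is differentiable, and pointwise inequalities for $T$ are understood at such points. A probability measure $\mu$ on $\mathbb{R}^d$ satisfies the Gaussian concentration property with constant $\beta>0$ if for every $1$-Lipschitz function $f:\mathbb{R}^d\to\mathbb{R}$ and every $r\ge 0$, $$\mu\left(\left\{f \geq \int f\,d\mu + r\right\}\right) \leq \exp(-\beta r^2/2).$$ *)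

theory Defs
  imports "HOL-Probability.Probability"
begin

text \<open>
  The dimension \<open>d\<close> is quantified inside the theorem (the constant in its first part must not
  depend on it), so \<open>\<real>\<^sup>d\<close> cannot be a type such as \<open>real ^ 'n\<close>. Vectors are the extensional
  functions on \<open>{..<d}\<close>, the space of the library's product measures; the Euclidean norm is
  \<^const>\<open>L2_set\<close>.
\<close>

definition Rd :: "nat \<Rightarrow> (nat \<Rightarrow> real) set" where
  "Rd d = {..<d} \<rightarrow>\<^sub>E UNIV"

definition enorm :: "nat \<Rightarrow> (nat \<Rightarrow> real) \<Rightarrow> real" where
  "enorm d x = L2_set x {..<d}"

definition edist :: "nat \<Rightarrow> (nat \<Rightarrow> real) \<Rightarrow> (nat \<Rightarrow> real) \<Rightarrow> real" where
  "edist d x y = L2_set (\<lambda>i. x i - y i) {..<d}"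

definition segment_point ::
    "nat \<Rightarrow> real \<Rightarrow> (nat \<Rightarrow> real) \<Rightarrow> (nat \<Rightarrow> real) \<Rightarrow> (nat \<Rightarrow> real)" where
  "segment_point d t x y = (\<lambda>i\<in>{..<d}. (1 - t) * x i + t * y i)"

definition borel_Rd :: "nat \<Rightarrow> (nat \<Rightarrow> real) measure" where
  "borel_Rd d = (\<Pi>\<^sub>M i\<in>{..<d}. borel)"

definition lborel_Rd :: "nat \<Rightarrow> (nat \<Rightarrow> real) measure" where
  "lborel_Rd d = (\<Pi>\<^sub>M i\<in>{..<d}. lborel)"

definition gaussian_Rd :: "nat \<Rightarrow> (nat \<Rightarrow> real) measure" where
  "gaussian_Rd d = (\<Pi>\<^sub>M i\<in>{..<d}. std_normal_distribution)"

definition prob_measure_Rd :: "nat \<Rightarrow> (nat \<Rightarrow> real) measure \<Rightarrow> bool" where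
  "prob_measure_Rd d \<mu> \<longleftrightarrow> prob_space \<mu> \<and> sets \<mu> = sets (borel_Rd d)"

definition centered :: "nat \<Rightarrow> (nat \<Rightarrow> real) measure \<Rightarrow> bool" where
  "centered d \<mu> \<longleftrightarrow> (\<forall>i<d. integrable \<mu> (\<lambda>x. x i) \<and> (\<integral>x. x i \<partial>\<mu>) = 0)"

definition covariance :: "(nat \<Rightarrow> real) measure \<Rightarrow> nat \<Rightarrow> nat \<Rightarrow> real" where
  "covariance \<mu> i j = (\<integral>x. (x i - (\<integral>y. y i \<partial>\<mu>)) * (x j - (\<integral>y. y j \<partial>\<mu>)) \<partial>\<mu>)"

text \<open>
  Square integrability makes the covariance matrix meaningful: a non-integrable function has
  Bochner integral 0.
\<close>

definition isotropic :: "nat \<Rightarrow> (nat \<Rightarrow> real) measure \<Rightarrow> bool" where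
  "isotropic d \<mu> \<longleftrightarrow>
     (\<forall>i<d. integrable \<mu> (\<lambda>x. x i) \<and> integrable \<mu> (\<lambda>x. (x i)\<^sup>2)) \<and>
     (\<forall>i<d. \<forall>j<d. covariance \<mu> i j = (if i = j then 1 else 0))"

text \<open>
  A density \<open>f = exp (- V)\<close> with \<open>V\<close> convex and possibly equal to \<open>+\<infinity>\<close>. As
  \<open>0 powr a = 0\<close>, the inequality is vacuous where \<open>f x = 0\<close> or \<open>f y = 0\<close>, as it should be.
\<close>

definition log_concave_measure :: "nat \<Rightarrow> (nat \<Rightarrow> real) measure \<Rightarrow> bool" where
  "log_concave_measure d \<mu> \<longleftrightarrow>
     (\<exists>f \<in> borel_measurable (lborel_Rd d).
        (\<forall>x\<in>Rd d. 0 \<le> f x) \<and>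
        (\<forall>x\<in>Rd d. \<forall>y\<in>Rd d. \<forall>t. 0 < t \<and> t < 1 \<longrightarrow>
           f x powr (1 - t) * f y powr t \<le> f (segment_point d t x y)) \<and>
        \<mu> = density (lborel_Rd d) (\<lambda>x. ennreal (f x)))"

definition one_lipschitz :: "nat \<Rightarrow> ((nat \<Rightarrow> real) \<Rightarrow> real) \<Rightarrow> bool" where
  "one_lipschitz d f \<longleftrightarrow> (\<forall>x\<in>Rd d. \<forall>y\<in>Rd d. \<bar>f x - f y\<bar> \<le> edist d x y)"

text \<open>
  Integrability is what the formula with \<open>\<integral> f d\<mu>\<close> presupposes. It holds automatically for
  Lipschitz functions when \<open>\<mu>\<close> is a centered probability measure.
\<close>

definition gaussian_concentration :: "nat \<Rightarrow> real \<Rightarrow> (nat \<Rightarrow> real) measure \<Rightarrow> bool" where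
  "gaussian_concentration d \<beta> \<mu> \<longleftrightarrow>
     (\<forall>f. one_lipschitz d f \<longrightarrow>
        integrable \<mu> f \<and>
        (\<forall>r\<ge>0. measure \<mu> {x \<in> space \<mu>. f x \<ge> (\<integral>y. f y \<partial>\<mu>) + r} \<le> exp (- \<beta> * r\<^sup>2 / 2)))"

text \<open>Convexity of a function \<open>\<real>\<^sup>d \<rightarrow> \<real> \<union> {+\<infinity>}\<close>; the value \<open>-\<infinity>\<close> of \<^typ>\<open>ereal\<close> is excluded.\<close>

definition convex_Rd :: "nat \<Rightarrow> ((nat \<Rightarrow> real) \<Rightarrow> ereal) \<Rightarrow> bool" where
  "convex_Rd d \<phi> \<longleftrightarrow>
     (\<forall>x\<in>Rd d. \<phi> x \<noteq> - \<infinity>) \<and>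
     (\<forall>x\<in>Rd d. \<forall>y\<in>Rd d. \<forall>t. 0 < t \<and> t < 1 \<longrightarrow>
        \<phi> (segment_point d t x y) \<le> ereal (1 - t) * \<phi> x + ereal t * \<phi> y)"

text \<open>Frechet differentiability at \<open>x\<close>, which includes finiteness in a neighbourhood of \<open>x\<close>.\<close>

definition has_gradient ::
    "nat \<Rightarrow> ((nat \<Rightarrow> real) \<Rightarrow> ereal) \<Rightarrow> (nat \<Rightarrow> real) \<Rightarrow> (nat \<Rightarrow> real) \<Rightarrow> bool" where
  "has_gradient d \<phi> v x \<longleftrightarrow> x \<in> Rd d \<and> v \<in> Rd d \<and>
     (\<forall>\<epsilon>>0. \<exists>\<delta>>0. \<forall>y\<in>Rd d. edist d y x < \<delta> \<longrightarrow>
        \<bar>\<phi> y\<bar> \<noteq> \<infinity> \<and>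
        \<bar>real_of_ereal (\<phi> y) - real_of_ereal (\<phi> x) - (\<Sum>i<d. v i * (y i - x i))\<bar>
          \<le> \<epsilon> * edist d y x)"

definition differentiable_Rd :: "nat \<Rightarrow> ((nat \<Rightarrow> real) \<Rightarrow> ereal) \<Rightarrow> (nat \<Rightarrow> real) \<Rightarrow> bool" where
  "differentiable_Rd d \<phi> x \<longleftrightarrow> (\<exists>v. has_gradient d \<phi> v x)"

text \<open>
  \<open>T\<close> is the Brenier map from the standard Gaussian measure onto \<open>\<mu>\<close>, with potential \<open>\<phi>\<close>.
  Its values outside the differentiability set of \<open>\<phi>\<close> (a null set) are irrelevant.
\<close>

definition brenier_map ::
    "nat \<Rightarrow> (nat \<Rightarrow> real) measure \<Rightarrow> ((nat \<Rightarrow> real) \<Rightarrow> ereal) \<Rightarrow>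
     ((nat \<Rightarrow> real) \<Rightarrow> (nat \<Rightarrow> real)) \<Rightarrow> bool" where
  "brenier_map d \<mu> \<phi> T \<longleftrightarrow>
     convex_Rd d \<phi> \<and>
     (AE x in gaussian_Rd d. differentiable_Rd d \<phi> x) \<and>
     (\<forall>x. differentiable_Rd d \<phi> x \<longrightarrow> has_gradient d \<phi> (T x) x) \<and>
     T \<in> measurable (gaussian_Rd d) (borel_Rd d) \<and>
     distr (gaussian_Rd d) (borel_Rd d) T = \<mu>"

end

theory Submission
  imports Defs
begin

text \<open>
  Let \<open>v = T x\<close>. Monotonicity of \<open>T\<close> forces \<open>|T y| \<ge> |v| / 2\<close> on a cone with vertex \<open>x\<close> and axis
  \<open>v\<close>. The cone contains a ball of radius \<open>sqrt (2 d)\<close> whose Gaussian measure is at least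
  \<open>exp (- |x|\<^sup>2 - 18 d) / 2\<close>, so this number is a lower bound for \<open>\<mu> (|z| \<ge> |v| / 2)\<close>. An upper
  bound for the tail of \<open>|z|\<close> under \<open>\<mu>\<close> then bounds \<open>|v|\<close>.

  Under Gaussian concentration the tail bound is the concentration of the norm around its mean,
  which is at most \<open>2 sqrt (d / \<beta>)\<close>. For an isotropic measure with log-concave density \<open>f\<close>, put
  \<open>I = \<integral> sqrt f\<close>. Midpoint log-concavity gives \<open>f w I\<^sup>2 \<le> 4\<^sup>d\<close> for all \<open>w\<close>; and if \<open>|z| \<ge> K s\<close> with
  \<open>s \<ge> d\<close>, then \<open>f z I\<^sup>2 < exp (- a s)\<close>, since otherwise a homothety of ratio
  \<open>1 - 1 / (2 s)\<close> centred at \<open>z\<close> would contradict Chebyshev's inequality in the direction of \<open>z\<close>.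
  Integrating \<open>f = sqrt f sqrt f\<close> gives \<open>\<mu> (|z| \<ge> K s) \<le> exp (- a s / 2)\<close>, with neither the
  Prekopa-Leindler inequality nor a bound on the isotropic constant.
\<close>

subsection \<open>Substitution in product measures\<close>

text \<open>Fubini peels off one coordinate at a time, so one-dimensional changes of variables
  tensorize. The weights and maps may vary with the coordinate because the shifts used later
  do.\<close>

lemma nn_integral_PiM_substitution:
  fixes M :: "'b measure" and h :: "'a \<Rightarrow> 'b \<Rightarrow> 'b" and k :: "'a \<Rightarrow> 'b \<Rightarrow> ennreal"
  assumes M: "sigma_finite_measure M" and I: "finite I"
    and h [measurable]: "\<And>i. h i \<in> M \<rightarrow>\<^sub>M M"
    and k [measurable]: "\<And>i. k i \<in> borel_measurable M"
    and sub: "\<And>i g. g \<in> borel_measurable M \<Longrightarrow>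
      (\<integral>\<^sup>+x. g x \<partial>M) = (\<integral>\<^sup>+x. k i x * g (h i x) \<partial>M)"
    and g: "g \<in> borel_measurable (\<Pi>\<^sub>M i\<in>I. M)"
  shows "(\<integral>\<^sup>+x. g x \<partial>(\<Pi>\<^sub>M i\<in>I. M)) =
    (\<integral>\<^sup>+x. (\<Prod>i\<in>I. k i (x i)) * g (\<lambda>i\<in>I. h i (x i)) \<partial>(\<Pi>\<^sub>M i\<in>I. M))"
  using I g
proof (induction I arbitrary: g)
  case empty
  have "(\<lambda>i\<in>{}. h i (x i)) = x" if "x \<in> space (\<Pi>\<^sub>M i\<in>{}. M)" for x
    using that by (auto simp: space_PiM)
  then show ?case by (intro nn_integral_cong) simp
next
  case (insert i I)
  interpret sigma_finite_measure M by fact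
  interpret P: product_sigma_finite "\<lambda>_. M" by standard
  have gm [measurable]: "g \<in> borel_measurable (\<Pi>\<^sub>M i\<in>insert i I. M)" by fact
  interpret F: finite_product_sigma_finite "\<lambda>_. M" I
    by standard (use insert in auto)
  \<comment> \<open>The inner integral, already substituted in coordinate \<open>i\<close>. It is a
    new integrand on the remaining coordinates, hence the induction over arbitrary
    \<open>g\<close>.\<close>
  define G where "G x = (\<integral>\<^sup>+y. k i y * g (x(i := h i y)) \<partial>M)" for x
  have G [measurable]: "G \<in> borel_measurable (\<Pi>\<^sub>M i\<in>I. M)"
    unfolding G_def by measurable
  have "(\<integral>\<^sup>+x. g x \<partial>(\<Pi>\<^sub>M i\<in>insert i I. M)) =
      (\<integral>\<^sup>+x. (\<integral>\<^sup>+y. g (x(i := y)) \<partial>M) \<partial>(\<Pi>\<^sub>M i\<in>I. M))"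
    using insert by (intro P.product_nn_integral_insert) auto
  also have "\<dots> = (\<integral>\<^sup>+x. G x \<partial>(\<Pi>\<^sub>M i\<in>I. M))"
    unfolding G_def by (intro nn_integral_cong sub) measurable
  also have "\<dots> = (\<integral>\<^sup>+x. (\<Prod>i\<in>I. k i (x i)) * G (\<lambda>i\<in>I. h i (x i)) \<partial>(\<Pi>\<^sub>M i\<in>I. M))"
    by (intro insert.IH G)
  also have "\<dots> = (\<integral>\<^sup>+x. (\<integral>\<^sup>+y. (\<Prod>j\<in>insert i I. k j ((x(i := y)) j)) *
      g (\<lambda>j\<in>insert i I. h j ((x(i := y)) j)) \<partial>M) \<partial>(\<Pi>\<^sub>M i\<in>I. M))"
  proof (intro nn_integral_cong)
    fix x assume x: "x \<in> space (\<Pi>\<^sub>M i\<in>I. M)"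
    have hx: "(\<lambda>i\<in>I. h i (x i)) \<in> space (\<Pi>\<^sub>M i\<in>I. M)"
      using x measurable_space[OF h] by (auto simp: space_PiM)
    have [measurable]: "(\<lambda>y. (\<lambda>i\<in>I. h i (x i))(i := h i y)) \<in> M \<rightarrow>\<^sub>M (\<Pi>\<^sub>M i\<in>insert i I. M)"
      using hx by measurable
    have "(\<Prod>i\<in>I. k i (x i)) * G (\<lambda>i\<in>I. h i (x i)) =
      (\<integral>\<^sup>+y. (\<Prod>i\<in>I. k i (x i)) * (k i y * g ((\<lambda>i\<in>I. h i (x i))(i := h i y))) \<partial>M)"
      unfolding G_def by (rule nn_integral_cmult[symmetric]) measurable
    also have "\<dots> = (\<integral>\<^sup>+y. (\<Prod>j\<in>insert i I. k j ((x(i := y)) j)) *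
      g (\<lambda>j\<in>insert i I. h j ((x(i := y)) j)) \<partial>M)"
    proof (intro nn_integral_cong)
      fix y
      have "(\<lambda>i\<in>I. h i (x i))(i := h i y) = (\<lambda>j\<in>insert i I. h j ((x(i := y)) j))"
        using insert by (auto simp: fun_eq_iff)
      moreover have "(\<Prod>j\<in>insert i I. k j ((x(i := y)) j)) = k i y * (\<Prod>j\<in>I. k j (x j))"
      proof -
        have "(\<Prod>j\<in>I. k j ((x(i := y)) j)) = (\<Prod>j\<in>I. k j (x j))"
          using insert by (intro prod.cong) auto
        then show ?thesis using insert by simp
      qed
      ultimately show "(\<Prod>i\<in>I. k i (x i)) * (k i y * g ((\<lambda>i\<in>I. h i (x i))(i := h i y))) =
        (\<Prod>j\<in>insert i I. k j ((x(i := y)) j)) * g (\<lambda>j\<in>insert i I. h j ((x(i := y)) j))"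
        by (simp add: mult_ac)
    qed
    finally show "(\<Prod>i\<in>I. k i (x i)) * G (\<lambda>i\<in>I. h i (x i)) = \<dots>" .
  qed
  also have "\<dots> = (\<integral>\<^sup>+x. (\<Prod>j\<in>insert i I. k j (x j)) *
      g (\<lambda>j\<in>insert i I. h j (x j)) \<partial>(\<Pi>\<^sub>M i\<in>insert i I. M))"
    using insert by (intro P.product_nn_integral_insert[symmetric]) auto
  finally show ?case .
qed

text \<open>Serves the midpoint map (\<open>c = 1 / 2\<close>) and the homothety of ratio slightly
  below 1; \<open>c ^ d\<close> is the Jacobian.\<close>

lemma nn_integral_lborel_Rd_affine:
  assumes c: "0 < c" and g: "g \<in> borel_measurable (lborel_Rd d)"
  shows "(\<integral>\<^sup>+x. g x \<partial>lborel_Rd d) =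
    ennreal (c ^ d) * (\<integral>\<^sup>+x. g (\<lambda>i\<in>{..<d}. v i + c * x i) \<partial>lborel_Rd d)"
proof -
  have [measurable]: "g \<in> borel_measurable (\<Pi>\<^sub>M i\<in>{..<d}. lborel)"
    using g by (simp add: lborel_Rd_def)
  have "(\<integral>\<^sup>+x. g x \<partial>lborel_Rd d) = (\<integral>\<^sup>+x. (\<Prod>i<d. ennreal c) * g (\<lambda>i\<in>{..<d}. v i + c * x i) \<partial>lborel_Rd d)"
    unfolding lborel_Rd_def
  proof (rule nn_integral_PiM_substitution[where k = "\<lambda>_ _. ennreal c" and h = "\<lambda>i x. v i + c * x"])
    show "(\<integral>\<^sup>+x. g x \<partial>lborel) = (\<integral>\<^sup>+x. ennreal c * g (v i + c * x) \<partial>lborel)"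
      if "g \<in> borel_measurable lborel" for g :: "real \<Rightarrow> ennreal" and i
      using that c by (subst nn_integral_real_affine[where c = c and t = "v i"])
        (auto simp: nn_integral_cmult)
  qed (auto intro: sigma_finite_lborel)
  also have "\<dots> = ennreal (c ^ d) * (\<integral>\<^sup>+x. g (\<lambda>i\<in>{..<d}. v i + c * x i) \<partial>lborel_Rd d)"
    using c by (simp add: nn_integral_cmult lborel_Rd_def ennreal_power)
  finally show ?thesis .
qed

text \<open>For \<open>s = 1\<close> this is a translation, for \<open>s = -1\<close> a reflection
  followed by a translation. The weight is the quotient of the densities at \<open>c + s * x\<close>
  and at \<open>x\<close>, in which the quadratic terms cancel.\<close>

lemma nn_integral_std_normal_shift:
  fixes g :: "real \<Rightarrow> ennreal"
  assumes s: "s\<^sup>2 = 1" and g [measurable]: "g \<in> borel_measurable borel"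
  shows "(\<integral>\<^sup>+x. g x \<partial>std_normal_distribution) =
    (\<integral>\<^sup>+x. ennreal (exp (- s * c * x - c\<^sup>2 / 2)) * g (c + s * x) \<partial>std_normal_distribution)"
proof -
  have s': "s * s = 1" "\<bar>s\<bar> = 1" "s \<noteq> 0"
    using s by (auto simp: power2_eq_1_iff)
  have d: "std_normal_density (c + s * x) = std_normal_density x * exp (- s * c * x - c\<^sup>2 / 2)" for x
  proof -
    have "(c + s * x)\<^sup>2 = x\<^sup>2 + 2 * s * c * x + c\<^sup>2"
      using s by (simp add: power2_sum power_mult_distrib)
    then show ?thesis
      by (simp add: std_normal_density_def mult_exp_exp add_divide_distrib diff_divide_distrib)
  qed
  have "(\<integral>\<^sup>+x. g x \<partial>std_normal_distribution) = (\<integral>\<^sup>+x. std_normal_density x * g x \<partial>lborel)"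
    by (simp add: nn_integral_density)
  also have "\<dots> = (\<integral>\<^sup>+x. std_normal_density (c + s * x) * g (c + s * x) \<partial>lborel)"
    using s' by (subst nn_integral_real_affine[where c = s and t = c]) auto
  also have "\<dots> = (\<integral>\<^sup>+x. std_normal_density x * (ennreal (exp (- s * c * x - c\<^sup>2 / 2)) * g (c + s * x)) \<partial>lborel)"
    unfolding d by (simp add: ennreal_mult mult.assoc)
  also have "\<dots> = (\<integral>\<^sup>+x. ennreal (exp (- s * c * x - c\<^sup>2 / 2)) * g (c + s * x) \<partial>std_normal_distribution)"
    by (simp add: nn_integral_density)
  finally show ?thesis .
qed

subsection \<open>Monotonicity of gradients\<close>

lemma enorm_sq: "(enorm d x)\<^sup>2 = (\<Sum>i<d. (x i)\<^sup>2)"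
  by (simp add: enorm_def L2_set_def sum_nonneg)

lemma enorm_nonneg [simp]: "0 \<le> enorm d x"
  by (simp add: enorm_def)

lemma inner_le_enorm: "(\<Sum>i<d. x i * y i) \<le> enorm d x * enorm d y"
proof -
  have "(\<Sum>i<d. x i * y i) \<le> (\<Sum>i<d. \<bar>x i\<bar> * \<bar>y i\<bar>)"
    by (intro sum_mono) (simp flip: abs_mult)
  also have "\<dots> \<le> enorm d x * enorm d y"
    unfolding enorm_def by (rule L2_set_mult_ineq)
  finally show ?thesis .
qed

lemma enorm_add_le: "enorm d (\<lambda>i. x i + y i) \<le> enorm d x + enorm d y"
  unfolding enorm_def by (rule L2_set_triangle_ineq)

lemma enorm_scale: "0 \<le> r \<Longrightarrow> enorm d (\<lambda>i. r * x i) = r * enorm d x"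
  unfolding enorm_def by (rule L2_set_right_distrib[symmetric])

lemma segment_point_in_Rd [simp]: "segment_point d t x y \<in> Rd d"
  by (simp add: segment_point_def Rd_def)

lemma edist_segment_point: "0 \<le> t \<Longrightarrow> edist d (segment_point d t x y) x = t * edist d y x"
  unfolding edist_def
  by (subst L2_set_right_distrib) (auto intro!: L2_set_cong simp: segment_point_def algebra_simps)

lemma has_gradient_finite:
  assumes "has_gradient d \<phi> v x"
  shows "\<bar>\<phi> x\<bar> \<noteq> \<infinity>"
proof -
  obtain \<delta> where "\<delta> > 0" "\<forall>y\<in>Rd d. edist d y x < \<delta> \<longrightarrow> \<bar>\<phi> y\<bar> \<noteq> \<infinity>"
    using assms unfolding has_gradient_def by (meson zero_less_one)
  moreover have "edist d x x = 0"
    by (simp add: edist_def L2_set_def)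
  ultimately show ?thesis
    using assms by (simp add: has_gradient_def)
qed

text \<open>By convexity the difference quotients along the segment from \<open>x\<close> to
  \<open>y\<close> stay below the increment of \<open>\<phi>\<close>, and they tend to the left side
  near \<open>x\<close>. The proof makes this limit quantitative through the gap
  \<open>\<eta>\<close>.\<close>

lemma has_gradient_imp_subgradient:
  assumes conv: "convex_Rd d \<phi>" and grad: "has_gradient d \<phi> v x"
    and y: "y \<in> Rd d" "\<bar>\<phi> y\<bar> \<noteq> \<infinity>"
  shows "(\<Sum>i<d. v i * (y i - x i)) \<le> real_of_ereal (\<phi> y) - real_of_ereal (\<phi> x)"
proof (rule ccontr)
  assume neg: "\<not> ?thesis"
  define S where "S = (\<Sum>i<d. v i * (y i - x i))"
  define D where "D = edist d y x"
  define \<eta> where "\<eta> = S - (real_of_ereal (\<phi> y) - real_of_ereal (\<phi> x))"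
  have \<eta>: "\<eta> > 0" using neg by (simp add: \<eta>_def S_def)
  have D: "D \<ge> 0" by (simp add: D_def edist_def)
  \<comment> \<open>This gives \<open>\<epsilon> * D < \<eta>\<close>; the summand 1 keeps the
    denominator positive when \<open>D = 0\<close>.\<close>
  define \<epsilon> where "\<epsilon> = \<eta> / (2 * (D + 1))"
  have \<epsilon>: "\<epsilon> > 0" using \<eta> D by (simp add: \<epsilon>_def)
  obtain \<delta> where \<delta>: "\<delta> > 0" "\<And>z. z \<in> Rd d \<Longrightarrow> edist d z x < \<delta> \<Longrightarrow> \<bar>\<phi> z\<bar> \<noteq> \<infinity> \<and>
        \<bar>real_of_ereal (\<phi> z) - real_of_ereal (\<phi> x) - (\<Sum>i<d. v i * (z i - x i))\<bar>
          \<le> \<epsilon> * edist d z x"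
    using grad \<epsilon> unfolding has_gradient_def by meson
  define t where "t = min (1/2) (\<delta> / (2 * (D + 1)))"
  have t: "0 < t" "t < 1" "t * D < \<delta>"
  proof -
    show "0 < t" "t < 1" using \<delta> D by (auto simp: t_def min_def)
    have "t * D \<le> \<delta> / (2 * (D + 1)) * D"
      using D by (intro mult_right_mono) (auto simp: t_def)
    also have "\<dots> < \<delta>" using \<delta>(1) D by (simp add: field_simps add_nonneg_pos)
    finally show "t * D < \<delta>" .
  qed
  define z where "z = segment_point d t x y"
  have zD: "edist d z x = t * D"
    using t by (simp add: z_def D_def edist_segment_point)
  have "(\<Sum>i<d. v i * (z i - x i)) = t * S"
    unfolding S_def sum_distrib_left
    by (intro sum.cong) (auto simp: z_def segment_point_def algebra_simps)
  then have fz: "\<bar>\<phi> z\<bar> \<noteq> \<infinity>" "\<bar>real_of_ereal (\<phi> z) - real_of_ereal (\<phi> x) - t * S\<bar> \<le> \<epsilon> * (t * D)"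
    using \<delta>(2)[of z] t zD by (auto simp: z_def)
  have "\<phi> z \<le> ereal (1 - t) * \<phi> x + ereal t * \<phi> y"
    using conv grad y t unfolding convex_Rd_def has_gradient_def z_def by blast
  then have "real_of_ereal (\<phi> z) \<le> (1 - t) * real_of_ereal (\<phi> x) + t * real_of_ereal (\<phi> y)"
    using fz(1) y(2) has_gradient_finite[OF grad]
    by (cases "\<phi> z"; cases "\<phi> x"; cases "\<phi> y") auto
  then have "t * \<eta> \<le> \<epsilon> * (t * D)"
    using fz(2) by (simp add: \<eta>_def algebra_simps abs_le_iff)
  then have "\<eta> \<le> \<epsilon> * D" using t by (simp add: mult.left_commute)
  moreover have "\<epsilon> * D < \<eta>"
    using \<eta> D by (simp add: \<epsilon>_def field_simps add_nonneg_pos)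
  ultimately show False by simp
qed

text \<open>Sum of the two subgradient inequalities, one based at \<open>x\<close> and one at
  \<open>y\<close>.\<close>

lemma gradient_monotone:
  assumes "convex_Rd d \<phi>" and "has_gradient d \<phi> v x" and "has_gradient d \<phi> w y"
  shows "(\<Sum>i<d. v i * (y i - x i)) \<le> (\<Sum>i<d. w i * (y i - x i))"
proof -
  have "x \<in> Rd d" "y \<in> Rd d"
    using assms by (auto simp: has_gradient_def)
  then have "(\<Sum>i<d. v i * (y i - x i)) \<le> real_of_ereal (\<phi> y) - real_of_ereal (\<phi> x)"
    "(\<Sum>i<d. w i * (x i - y i)) \<le> real_of_ereal (\<phi> x) - real_of_ereal (\<phi> y)"
    using assms by (auto intro!: has_gradient_imp_subgradient has_gradient_finite)
  moreover have "(\<Sum>i<d. w i * (x i - y i)) = - (\<Sum>i<d. w i * (y i - x i))"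
    by (simp add: algebra_simps flip: sum_negf)
  ultimately show ?thesis by linarith
qed

subsection \<open>Gaussian mass of balls\<close>

lemma space_borel_Rd: "space (borel_Rd d) = Rd d"
  by (simp add: borel_Rd_def Rd_def space_PiM)

lemma sets_lborel_Rd: "sets (lborel_Rd d) = sets (borel_Rd d)"
  unfolding lborel_Rd_def borel_Rd_def by (intro sets_PiM_cong) auto

lemma sets_gaussian_Rd: "sets (gaussian_Rd d) = sets (borel_Rd d)"
  unfolding gaussian_Rd_def borel_Rd_def by (intro sets_PiM_cong) auto

lemma space_gaussian_Rd: "space (gaussian_Rd d) = Rd d"
  using sets_eq_imp_space_eq[OF sets_gaussian_Rd] by (simp add: space_borel_Rd)

lemma space_lborel_Rd: "space (lborel_Rd d) = Rd d"
  using sets_eq_imp_space_eq[OF sets_lborel_Rd] by (simp add: space_borel_Rd)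

lemma measurable_component_Rd [measurable]: "(\<lambda>x. x i) \<in> borel_measurable (borel_Rd d)" if "i < d"
  using that unfolding borel_Rd_def by (intro measurable_component_singleton) simp

lemma measurable_sum_Rd [measurable]:
  assumes "\<And>i. g i \<in> borel_measurable borel"
  shows "(\<lambda>x. \<Sum>i<d. g i (x i) :: real) \<in> borel_measurable (borel_Rd d)"
proof (rule borel_measurable_sum)
  fix i assume "i \<in> {..<d}"
  then have [measurable]: "(\<lambda>x. x i) \<in> borel_measurable (borel_Rd d)"
    by simp
  show "(\<lambda>x. g i (x i)) \<in> borel_measurable (borel_Rd d)"
    by (rule measurable_compose[OF _ assms]) measurable
qed

lemma measurable_enorm [measurable]: "enorm d \<in> borel_measurable (borel_Rd d)"
proof -
  have [measurable]: "(\<lambda>x. \<Sum>i<d. (x i)\<^sup>2) \<in> borel_measurable (borel_Rd d)"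
    by measurable
  show ?thesis
    unfolding enorm_def L2_set_def by measurable
qed

lemma measurable_edist [measurable]: "(\<lambda>y. edist d y c) \<in> borel_measurable (borel_Rd d)"
proof -
  have [measurable]: "(\<lambda>x. \<Sum>i<d. (x i - c i)\<^sup>2) \<in> borel_measurable (borel_Rd d)"
    by measurable
  show ?thesis
    unfolding edist_def L2_set_def by measurable
qed

section \<open>The standard Gaussian measure and its second moment\<close>

lemma prob_space_std_normal: "prob_space std_normal_distribution"
  by (rule prob_space_normal_density) simp

lemma prob_space_gaussian_Rd: "prob_space (gaussian_Rd d)"
  unfolding gaussian_Rd_def by (intro prob_space_PiM prob_space_std_normal)

lemma nn_integral_std_normal_square: "(\<integral>\<^sup>+x. ennreal (x\<^sup>2) \<partial>std_normal_distribution) = 1"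
proof -
  have "has_bochner_integral lborel (\<lambda>x. std_normal_density x * x\<^sup>2) 1"
    using std_normal_moment_even[of 1] by simp
  then have "(\<integral>\<^sup>+x. ennreal (std_normal_density x * x\<^sup>2) \<partial>lborel) = 1"
    by (auto simp: has_bochner_integral_iff nn_integral_eq_integral)
  then show ?thesis
    by (simp add: nn_integral_density ennreal_mult)
qed

lemma gaussian_Rd_second_moment:
  "(\<integral>\<^sup>+x. ennreal ((enorm d x)\<^sup>2) \<partial>gaussian_Rd d) = ennreal (real d)"
proof -
  have m: "(\<lambda>x. x i) \<in> gaussian_Rd d \<rightarrow>\<^sub>M std_normal_distribution" if "i < d" for i
    using that unfolding gaussian_Rd_def by (intro measurable_component_singleton) simp
  have "(\<integral>\<^sup>+x. ennreal ((enorm d x)\<^sup>2) \<partial>gaussian_Rd d) =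
      (\<integral>\<^sup>+x. (\<Sum>i<d. ennreal ((x i)\<^sup>2)) \<partial>gaussian_Rd d)"
    by (simp add: enorm_sq)
  also have "\<dots> = (\<Sum>i<d. \<integral>\<^sup>+x. ennreal ((x i)\<^sup>2) \<partial>gaussian_Rd d)"
  proof (rule nn_integral_sum)
    fix i assume "i \<in> {..<d}"
    then have [measurable]: "(\<lambda>x. x i) \<in> borel_measurable (borel_Rd d)"
      by simp
    note [measurable_cong] = sets_gaussian_Rd
    show "(\<lambda>x. ennreal ((x i)\<^sup>2)) \<in> borel_measurable (gaussian_Rd d)"
      by measurable
  qed
  also have "\<dots> = (\<Sum>i<d. 1)"
  proof (intro sum.cong refl)
    fix i assume i: "i \<in> {..<d}"
    have "(\<integral>\<^sup>+x. ennreal ((x i)\<^sup>2) \<partial>gaussian_Rd d) =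
        (\<integral>\<^sup>+x. ennreal (x\<^sup>2) \<partial>distr (gaussian_Rd d) std_normal_distribution (\<lambda>x. x i))"
      using i by (subst nn_integral_distr[OF m]) auto
    also have "distr (gaussian_Rd d) std_normal_distribution (\<lambda>x. x i) = std_normal_distribution"
      unfolding gaussian_Rd_def using i
      by (intro distr_PiM_component[where M = "\<lambda>_. std_normal_distribution"] prob_space_std_normal) auto
    finally show "(\<integral>\<^sup>+x. ennreal ((x i)\<^sup>2) \<partial>gaussian_Rd d) = 1"
      by (simp add: nn_integral_std_normal_square)
  qed
  finally show ?thesis
    by (simp add: ennreal_of_nat_eq_real_of_nat)
qed

text \<open>Markov's inequality for the squared norm, whose Gaussian mean is \<open>d\<close>, at
  level \<open>2 * d\<close>.\<close>

lemma gaussian_Rd_ball_0: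
  assumes "d \<ge> 1"
  shows "measure (gaussian_Rd d) {x \<in> Rd d. enorm d x \<le> sqrt (2 * real d)} \<ge> 1 / 2"
proof -
  interpret prob_space "gaussian_Rd d" by (rule prob_space_gaussian_Rd)
  note [measurable_cong] = sets_gaussian_Rd
  define B where "B = {x \<in> space (gaussian_Rd d). 1 \<le> ennreal (1 / (2 * real d)) * ennreal ((enorm d x)\<^sup>2)}"
  have [measurable]: "B \<in> sets (gaussian_Rd d)"
    unfolding B_def by measurable
  have "emeasure (gaussian_Rd d) B \<le> ennreal (1 / (2 * real d)) *
      (\<integral>\<^sup>+x. ennreal ((enorm d x)\<^sup>2) * indicator (space (gaussian_Rd d)) x \<partial>gaussian_Rd d)"
    unfolding B_def by (rule nn_integral_Markov_inequality) measurable
  also have "(\<integral>\<^sup>+x. ennreal ((enorm d x)\<^sup>2) * indicator (space (gaussian_Rd d)) x \<partial>gaussian_Rd d) = ennreal (real d)"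
    unfolding gaussian_Rd_second_moment[symmetric] by (intro nn_integral_cong) simp
  also have "ennreal (1 / (2 * real d)) * ennreal (real d) = ennreal (1 / 2)"
    using assms by (simp flip: ennreal_mult)
  finally have "prob B \<le> 1 / 2"
    unfolding emeasure_eq_measure by (subst (asm) ennreal_le_iff) auto
  then have "1 / 2 \<le> prob (space (gaussian_Rd d) - B)"
    by (simp add: prob_compl)
  also have "\<dots> \<le> prob {x \<in> Rd d. enorm d x \<le> sqrt (2 * real d)}"
  proof (rule finite_measure_mono)
    show "{x \<in> Rd d. enorm d x \<le> sqrt (2 * real d)} \<in> sets (gaussian_Rd d)"
      unfolding space_gaussian_Rd[symmetric] by measurable
    show "space (gaussian_Rd d) - B \<subseteq> {x \<in> Rd d. enorm d x \<le> sqrt (2 * real d)}"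
    proof
      fix x assume x: "x \<in> space (gaussian_Rd d) - B"
      then have "\<not> 1 \<le> 1 / (2 * real d) * (enorm d x)\<^sup>2"
        by (auto simp: B_def simp flip: ennreal_mult ennreal_1)
      then have "(enorm d x)\<^sup>2 \<le> 2 * real d"
        using assms by (simp add: field_simps)
      then show "x \<in> {x \<in> Rd d. enorm d x \<le> sqrt (2 * real d)}"
        using x by (auto simp: space_gaussian_Rd intro: real_le_rsqrt)
    qed
  qed
  finally show ?thesis .
qed

lemma nn_integral_gaussian_Rd_shift:
  assumes s: "s\<^sup>2 = 1" and g: "g \<in> borel_measurable (gaussian_Rd d)"
  shows "(\<integral>\<^sup>+x. g x \<partial>gaussian_Rd d) =
    (\<integral>\<^sup>+x. ennreal (exp (- s * (\<Sum>i<d. c i * x i) - (enorm d c)\<^sup>2 / 2)) *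
      g (\<lambda>i\<in>{..<d}. c i + s * x i) \<partial>gaussian_Rd d)"
proof -
  have "(\<integral>\<^sup>+x. g x \<partial>gaussian_Rd d) =
    (\<integral>\<^sup>+x. (\<Prod>i<d. ennreal (exp (- s * c i * x i - (c i)\<^sup>2 / 2))) *
      g (\<lambda>i\<in>{..<d}. c i + s * x i) \<partial>gaussian_Rd d)"
    unfolding gaussian_Rd_def
  proof (rule nn_integral_PiM_substitution[where
        k = "\<lambda>i x. ennreal (exp (- s * c i * x - (c i)\<^sup>2 / 2))" and h = "\<lambda>i x. c i + s * x"])
    show "sigma_finite_measure std_normal_distribution"
      using prob_space_std_normal prob_space_imp_sigma_finite by blast
    show "(\<integral>\<^sup>+x. g x \<partial>std_normal_distribution) = (\<integral>\<^sup>+x. ennreal (exp (- s * c i * x - (c i)\<^sup>2 / 2)) *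
        g (c i + s * x) \<partial>std_normal_distribution)"
      if "g \<in> borel_measurable std_normal_distribution" for g :: "real \<Rightarrow> ennreal" and i
      using that by (intro nn_integral_std_normal_shift s) simp
    show "g \<in> borel_measurable (\<Pi>\<^sub>M i\<in>{..<d}. std_normal_distribution)"
      using g by (simp add: gaussian_Rd_def)
  qed auto
  moreover have "(\<Prod>i<d. ennreal (exp (- s * c i * x i - (c i)\<^sup>2 / 2))) =
      ennreal (exp (- s * (\<Sum>i<d. c i * x i) - (enorm d c)\<^sup>2 / 2))" for x
    by (simp add: prod_ennreal exp_sum[symmetric] enorm_sq sum_subtractf sum_distrib_left
        sum_divide_distrib sum_negf mult.assoc)
  ultimately show ?thesis by simp
qed

text \<open>Averaging the two substitutions \<open>y = c + x\<close> and \<open>y = c - x\<close> gives a weight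
  \<open>cosh \<langle>c, x\<rangle> \<ge> 1\<close>.\<close>

lemma gaussian_Rd_ball_shift:
  "exp (- (enorm d c)\<^sup>2 / 2) * measure (gaussian_Rd d) {x \<in> Rd d. enorm d x \<le> R}
    \<le> measure (gaussian_Rd d) {y \<in> Rd d. edist d y c \<le> R}"
proof -
  interpret prob_space "gaussian_Rd d" by (rule prob_space_gaussian_Rd)
  note [measurable_cong] = sets_gaussian_Rd
  define A where "A = {x \<in> Rd d. enorm d x \<le> R}"
  define B where "B = {y \<in> Rd d. edist d y c \<le> R}"
  have [measurable]: "A \<in> sets (gaussian_Rd d)" "B \<in> sets (gaussian_Rd d)"
    unfolding A_def B_def space_gaussian_Rd[symmetric] by measurable
  have [measurable]: "(\<lambda>x. \<Sum>i<d. c i * x i) \<in> borel_measurable (borel_Rd d)"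
    by measurable
  define w where "w s x = ennreal (exp (- s * (\<Sum>i<d. c i * x i) - (enorm d c)\<^sup>2 / 2))" for s x
  have w [measurable]: "w s \<in> borel_measurable (gaussian_Rd d)" for s
    unfolding w_def by measurable
  \<comment> \<open>Both substitutions turn the ball about \<open>c\<close> into the same centred
    ball \<open>A\<close>; only the weight depends on the sign \<open>s\<close>.\<close>
  have eB: "emeasure (gaussian_Rd d) B = (\<integral>\<^sup>+x. w s x * indicator A x \<partial>gaussian_Rd d)"
    if s: "s\<^sup>2 = 1" for s
  proof -
    have "emeasure (gaussian_Rd d) B = (\<integral>\<^sup>+x. indicator B x \<partial>gaussian_Rd d)"
      by simp
    also have "\<dots> = (\<integral>\<^sup>+x. w s x * indicator B (\<lambda>i\<in>{..<d}. c i + s * x i) \<partial>gaussian_Rd d)"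
      unfolding w_def by (rule nn_integral_gaussian_Rd_shift[OF s]) measurable
    also have "\<dots> = (\<integral>\<^sup>+x. w s x * indicator A x \<partial>gaussian_Rd d)"
    proof (intro nn_integral_cong)
      fix x assume x: "x \<in> space (gaussian_Rd d)"
      have "edist d (\<lambda>i\<in>{..<d}. c i + s * x i) c = L2_set (\<lambda>i. s * x i) {..<d}"
        unfolding edist_def by (intro L2_set_cong) auto
      also have "\<dots> = enorm d x"
        using s by (simp add: enorm_def L2_set_def power_mult_distrib)
      finally show "w s x * indicator B (\<lambda>i\<in>{..<d}. c i + s * x i) = w s x * indicator A x"
        using x by (auto simp: A_def B_def indicator_def space_gaussian_Rd Rd_def)
    qed
    finally show ?thesis .
  qed
  have "2 * (ennreal (exp (- (enorm d c)\<^sup>2 / 2)) * emeasure (gaussian_Rd d) A) =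
      (\<integral>\<^sup>+x. 2 * ennreal (exp (- (enorm d c)\<^sup>2 / 2)) * indicator A x \<partial>gaussian_Rd d)"
    by (simp add: nn_integral_cmult mult.assoc)
  also have "\<dots> \<le> (\<integral>\<^sup>+x. w 1 x * indicator A x + w (-1) x * indicator A x \<partial>gaussian_Rd d)"
  proof (intro nn_integral_mono)
    fix x
    define u where "u = (\<Sum>i<d. c i * x i)"
    define e where "e = (enorm d c)\<^sup>2 / 2"
    have "2 \<le> exp (- u) + exp u"
      using exp_ge_add_one_self[of u] exp_ge_add_one_self[of "- u"] by linarith
    then have "2 * exp (- e) \<le> exp (- e) * (exp (- u) + exp u)"
      by (simp add: mult.commute[of 2])
    then have "2 * exp (- e) \<le> exp (- u - e) + exp (u - e)"
      by (simp add: exp_diff exp_minus field_simps)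
    then have "ennreal (2 * exp (- e)) \<le> w 1 x + w (- 1) x"
      by (simp add: w_def u_def e_def flip: ennreal_plus)
    then have "2 * ennreal (exp (- (enorm d c)\<^sup>2 / 2)) \<le> w 1 x + w (- 1) x"
      by (simp add: e_def ennreal_mult)
    then show "2 * ennreal (exp (- (enorm d c)\<^sup>2 / 2)) * indicator A x \<le>
        w 1 x * indicator A x + w (- 1) x * indicator A x"
      by (auto simp: indicator_def)
  qed
  also have "\<dots> = emeasure (gaussian_Rd d) B + emeasure (gaussian_Rd d) B"
    using eB[of 1] eB[of "-1"] by (simp add: nn_integral_add)
  finally show ?thesis
    unfolding A_def[symmetric] B_def[symmetric] emeasure_eq_measure
    by (simp flip: ennreal_mult ennreal_plus ennreal_numeral)
qed

lemma gaussian_Rd_ball_lower_bound: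
  assumes "d \<ge> 1"
  shows "exp (- (enorm d c)\<^sup>2 / 2) / 2
    \<le> measure (gaussian_Rd d) {y \<in> Rd d. edist d y c \<le> sqrt (2 * real d)}"
proof -
  have "exp (- (enorm d c)\<^sup>2 / 2) * (1 / 2) \<le> exp (- (enorm d c)\<^sup>2 / 2) *
      measure (gaussian_Rd d) {x \<in> Rd d. enorm d x \<le> sqrt (2 * real d)}"
    using gaussian_Rd_ball_0[OF assms] by (intro mult_left_mono) auto
  also have "\<dots> \<le> measure (gaussian_Rd d) {y \<in> Rd d. edist d y c \<le> sqrt (2 * real d)}"
    by (rule gaussian_Rd_ball_shift)
  finally show ?thesis by simp
qed

text \<open>With \<open>e = T x / |T x|\<close> and \<open>R = sqrt (2 d)\<close>, the ball of radius \<open>R\<close> about \<open>x + 3 R e\<close>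
  lies in the cone with vertex \<open>x\<close> on which monotonicity forces \<open>|T y| \<ge> |T x| / 2\<close>.\<close>

lemma brenier_map_tail_lower_bound:
  assumes d: "d \<ge> 1" and T: "brenier_map d \<mu> \<phi> T" and x: "x \<in> Rd d" "differentiable_Rd d \<phi> x"
  shows "exp (- (enorm d x)\<^sup>2 - 18 * real d) / 2
    \<le> measure \<mu> {z \<in> Rd d. enorm d (T x) / 2 \<le> enorm d z}"
proof -
  interpret prob_space "gaussian_Rd d" by (rule prob_space_gaussian_Rd)
  note [measurable_cong] = sets_gaussian_Rd
  have conv: "convex_Rd d \<phi>" and ae: "AE y in gaussian_Rd d. differentiable_Rd d \<phi> y"
    and grad: "\<And>y. differentiable_Rd d \<phi> y \<Longrightarrow> has_gradient d \<phi> (T y) y"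
    and Tm [measurable]: "T \<in> gaussian_Rd d \<rightarrow>\<^sub>M borel_Rd d"
    and \<mu>: "\<mu> = distr (gaussian_Rd d) (borel_Rd d) T"
    using T by (auto simp: brenier_map_def)
  define V where "V = enorm d (T x)"
  define R where "R = sqrt (2 * real d)"
  have R: "R > 0" "R\<^sup>2 = 2 * real d" using d by (auto simp: R_def)
  have V: "V \<ge> 0" by (simp add: V_def)
  \<comment> \<open>If \<open>V = 0\<close>, division by zero makes \<open>e\<close> the zero
    vector. The two facts below survive this case, which is why the norm of \<open>e\<close> is only
    bounded by 1.\<close>
  define e where "e i = T x i / V" for i
  define c where "c i = x i + 3 * R * e i" for i
  have e_norm: "enorm d e \<le> 1"
  proof -
    have "e = (\<lambda>i. inverse V * T x i)"
      by (simp add: e_def fun_eq_iff field_simps)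
    then have "enorm d e = inverse V * V"
      using enorm_scale[of "inverse V" d "T x"] V by (simp flip: V_def)
    also have "\<dots> \<le> 1" by (cases "V = 0") auto
    finally show ?thesis .
  qed
  have Te: "(\<Sum>i<d. T x i * e i) = V"
  proof -
    have "V\<^sup>2 = (\<Sum>i<d. T x i * T x i)"
      unfolding V_def enorm_sq by (simp add: power2_eq_square)
    then have "(\<Sum>i<d. T x i * e i) = V\<^sup>2 / V"
      by (simp add: e_def sum_divide_distrib)
    then show ?thesis by (simp add: power2_eq_square)
  qed
  \<comment> \<open>The constant 18 arises here: half of \<open>2 * (3 * R)\<^sup>2\<close> equals
    \<open>9 * R\<^sup>2 = 18 * real d\<close>.\<close>
  have c_norm: "(enorm d c)\<^sup>2 / 2 \<le> (enorm d x)\<^sup>2 + 18 * real d"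
  proof -
    have "enorm d c \<le> enorm d x + enorm d (\<lambda>i. (3 * R) * e i)"
      unfolding c_def[abs_def] by (rule enorm_add_le)
    also have "\<dots> \<le> enorm d x + 3 * R"
      using e_norm R by (simp add: enorm_scale)
    finally have "(enorm d c)\<^sup>2 \<le> (enorm d x + 3 * R)\<^sup>2"
      by (intro power_mono) auto
    also have "\<dots> \<le> 2 * (enorm d x)\<^sup>2 + 2 * (3 * R)\<^sup>2"
      using sum_squares_bound[of "enorm d x" "3 * R"] by (simp add: power2_sum)
    finally show ?thesis using R by (simp add: power_mult_distrib)
  qed
  define B where "B = {y \<in> Rd d. edist d y c \<le> R}"
  define A where "A = {z \<in> Rd d. V / 2 \<le> enorm d z}"
  have [measurable]: "B \<in> sets (gaussian_Rd d)" "A \<in> sets (borel_Rd d)"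
    unfolding A_def B_def space_borel_Rd[symmetric] by measurable
  \<comment> \<open>Write \<open>y - x = 3 R e + u\<close> with \<open>u\<close> of norm at most
    \<open>R\<close>. Then the inner product of \<open>T x\<close> with \<open>y - x\<close> is at
    least \<open>2 R V\<close>, while \<open>y - x\<close> has norm at most \<open>4 R\<close>;
    monotonicity and Cauchy-Schwarz leave the ratio 1/2.\<close>
  have key: "V / 2 \<le> enorm d (T y)" if y: "y \<in> B" "differentiable_Rd d \<phi> y" for y
  proof -
    define u where "u i = y i - c i" for i
    have u: "enorm d u \<le> R" using y by (simp add: B_def u_def[abs_def] enorm_def edist_def)
    have yx: "y i - x i = 3 * R * e i + u i" for i
      by (simp add: u_def c_def)
    have "(\<Sum>i<d. T x i * (- u i)) \<le> V * enorm d (\<lambda>i. - u i)"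
      unfolding V_def by (rule inner_le_enorm)
    also have "\<dots> \<le> V * R"
      using u V by (intro mult_left_mono) (auto simp: enorm_def L2_set_def)
    finally have "- (V * R) \<le> (\<Sum>i<d. T x i * u i)"
      by (simp add: sum_negf)
    moreover have "(\<Sum>i<d. T x i * (y i - x i)) = 3 * R * V + (\<Sum>i<d. T x i * u i)"
      unfolding yx Te[symmetric] by (simp add: algebra_simps sum.distrib sum_distrib_left)
    ultimately have "2 * R * V \<le> (\<Sum>i<d. T x i * (y i - x i))"
      by (simp add: mult.commute[of V R])
    also have "\<dots> \<le> (\<Sum>i<d. T y i * (y i - x i))"
      by (rule gradient_monotone[OF conv grad[OF x(2)] grad[OF y(2)]])
    also have "\<dots> \<le> enorm d (T y) * enorm d (\<lambda>i. y i - x i)"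
      by (rule inner_le_enorm)
    also have "\<dots> \<le> enorm d (T y) * (4 * R)"
    proof (intro mult_left_mono)
      have "enorm d (\<lambda>i. y i - x i) \<le> enorm d (\<lambda>i. (3 * R) * e i) + enorm d u"
        unfolding yx by (rule enorm_add_le)
      also have "\<dots> \<le> 3 * R + R"
        using e_norm R u by (intro add_mono) (auto simp: enorm_scale)
      finally show "enorm d (\<lambda>i. y i - x i) \<le> 4 * R" by simp
    qed simp
    finally have "R * V \<le> R * (2 * enorm d (T y))" by simp
    then show ?thesis using R(1) by simp
  qed
  have "exp (- (enorm d x)\<^sup>2 - 18 * real d) / 2 \<le> exp (- (enorm d c)\<^sup>2 / 2) / 2"
    using c_norm by simp
  also have "\<dots> \<le> prob B"
    unfolding B_def R_def by (rule gaussian_Rd_ball_lower_bound[OF d])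
  \<comment> \<open>The inclusion holds only almost everywhere, since \<open>key\<close> needs
    differentiability at \<open>y\<close>.\<close>
  also have "\<dots> \<le> prob (T -` A \<inter> space (gaussian_Rd d))"
  proof (rule finite_measure_mono_AE)
    show "AE y in gaussian_Rd d. y \<in> B \<longrightarrow> y \<in> T -` A \<inter> space (gaussian_Rd d)"
      using ae AE_space
    proof eventually_elim
      case (elim y)
      then show ?case
        using key[of y] measurable_space[OF Tm, of y] by (auto simp: A_def space_borel_Rd)
    qed
  qed measurable
  also have "\<dots> = measure \<mu> A"
    unfolding \<mu> by (simp add: measure_distr)
  finally show ?thesis by (simp add: A_def V_def)
qed

subsection \<open>Gaussian concentration\<close>

text \<open>Layer-cake formula: write the square of \<open>X\<close> as the integral of
  \<open>2 * t\<close> over \<open>{0..\<bar>X x\<bar>}\<close>, exchange the integrals and insert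
  the tail bound.\<close>

lemma (in prob_space) nn_integral_square_le_of_subgaussian_tail:
  assumes X [measurable]: "X \<in> borel_measurable M" and \<beta>: "\<beta> > 0"
    and tail: "\<And>r. r \<ge> 0 \<Longrightarrow> prob {x \<in> space M. r \<le> \<bar>X x\<bar>} \<le> 2 * exp (- \<beta> * r\<^sup>2 / 2)"
  shows "(\<integral>\<^sup>+x. ennreal ((X x)\<^sup>2) \<partial>M) \<le> ennreal (4 / \<beta>)"
proof -
  interpret L: pair_sigma_finite M "lborel :: real measure" by standard
  \<comment> \<open>Antiderivative of the resulting integrand
    \<open>4 * t * exp (- \<beta> * t\<^sup>2 / 2)\<close>; it vanishes at infinity, so the integral
    is \<open>- F 0\<close>.\<close>
  define F where "F t = - (4 / \<beta>) * exp (- \<beta> * t\<^sup>2 / 2)" for t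
  have "(\<integral>\<^sup>+x. ennreal ((X x)\<^sup>2) \<partial>M) =
      (\<integral>\<^sup>+x. (\<integral>\<^sup>+t. ennreal (2 * t) * indicator {0..\<bar>X x\<bar>} t \<partial>lborel) \<partial>M)"
  proof (intro nn_integral_cong)
    fix x
    have "(\<integral>\<^sup>+t. ennreal (2 * t) * indicator {0..\<bar>X x\<bar>} t \<partial>lborel) = ennreal (\<bar>X x\<bar>\<^sup>2 - 0\<^sup>2)"
      by (rule nn_integral_FTC_Icc[where F = "\<lambda>t. t\<^sup>2"]) (auto intro!: derivative_eq_intros)
    then show "ennreal ((X x)\<^sup>2) = (\<integral>\<^sup>+t. ennreal (2 * t) * indicator {0..\<bar>X x\<bar>} t \<partial>lborel)"
      by simp
  qed
  also have "\<dots> = (\<integral>\<^sup>+t. (\<integral>\<^sup>+x. ennreal (2 * t) * indicator {0..\<bar>X x\<bar>} t \<partial>M) \<partial>lborel)"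
    by (rule L.Fubini'[symmetric]) (simp add: indicator_def)
  also have "\<dots> \<le> (\<integral>\<^sup>+t. ennreal (4 * t * exp (- \<beta> * t\<^sup>2 / 2)) * indicator {0..} t \<partial>lborel)"
  proof (intro nn_integral_mono)
    fix t :: real
    show "(\<integral>\<^sup>+x. ennreal (2 * t) * indicator {0..\<bar>X x\<bar>} t \<partial>M)
        \<le> ennreal (4 * t * exp (- \<beta> * t\<^sup>2 / 2)) * indicator {0..} t"
    proof (cases "t \<ge> 0")
      case True
      have "(\<integral>\<^sup>+x. ennreal (2 * t) * indicator {0..\<bar>X x\<bar>} t \<partial>M) =
          (\<integral>\<^sup>+x. ennreal (2 * t) * indicator {x \<in> space M. t \<le> \<bar>X x\<bar>} x \<partial>M)"
        using True by (intro nn_integral_cong) (auto simp: indicator_def)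
      also have "\<dots> = ennreal (2 * t) * emeasure M {x \<in> space M. t \<le> \<bar>X x\<bar>}"
        by (rule nn_integral_cmult_indicator) measurable
      also have "\<dots> \<le> ennreal (2 * t) * ennreal (2 * exp (- \<beta> * t\<^sup>2 / 2))"
        unfolding emeasure_eq_measure using tail[OF True] by (intro mult_left_mono ennreal_leI) auto
      also have "\<dots> = ennreal (4 * t * exp (- \<beta> * t\<^sup>2 / 2))"
        using True by (simp flip: ennreal_mult)
      finally show ?thesis using True by simp
    qed simp
  qed
  also have "\<dots> = ennreal (0 - F 0)"
  proof (rule nn_integral_FTC_atLeast)
    show "(F has_real_derivative 4 * t * exp (- \<beta> * t\<^sup>2 / 2)) (at t)" for t
      unfolding F_def using \<beta> by (auto intro!: derivative_eq_intros simp: field_simps)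
    have "filterlim (\<lambda>t::real. (\<beta> / 2) * t\<^sup>2) at_top at_top"
      using \<beta> by (intro filterlim_tendsto_pos_mult_at_top[OF tendsto_const] filterlim_pow_at_top filterlim_ident) auto
    then have "filterlim (\<lambda>t::real. - \<beta> * t\<^sup>2 / 2) at_bot at_top"
      by (simp add: filterlim_uminus_at_top)
    then have "((\<lambda>t. exp (- \<beta> * t\<^sup>2 / 2)) \<longlongrightarrow> 0) at_top"
      by (rule filterlim_compose[OF exp_at_bot])
    then show "(F \<longlongrightarrow> 0) at_top"
      unfolding F_def by (rule tendsto_mult_right_zero)
  qed auto
  finally show ?thesis by (simp add: F_def)
qed

section \<open>The mean of the norm under concentration\<close>

lemma abs_diff_le_edist: "i < d \<Longrightarrow> \<bar>x i - y i\<bar> \<le> edist d x y"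
  using member_le_L2_set[of "{..<d}" i "\<lambda>i. \<bar>x i - y i\<bar>"]
  by (simp add: edist_def L2_set_def)

lemma one_lipschitz_enorm: "one_lipschitz d (enorm d)"
proof -
  have "enorm d x \<le> enorm d y + edist d x y" for x y
    using enorm_add_le[of d y "\<lambda>i. x i - y i"] by (simp add: edist_def enorm_def)
  moreover have "edist d x y = edist d y x" for x y
    by (simp add: edist_def L2_set_def power2_commute)
  ultimately show ?thesis
    unfolding one_lipschitz_def by (metis abs_diff_le_iff add.commute diff_le_eq minus_diff_eq)
qed

text \<open>A coordinate and its negative are both 1-Lipschitz with mean 0; the union bound costs
  the factor 2.\<close>

lemma gaussian_concentration_coordinate_tail:
  assumes \<mu>: "prob_measure_Rd d \<mu>" "centered d \<mu>" "gaussian_concentration d \<beta> \<mu>"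
    and i: "i < d" and r: "r \<ge> 0"
  shows "measure \<mu> {x \<in> space \<mu>. r \<le> \<bar>x i\<bar>} \<le> 2 * exp (- \<beta> * r\<^sup>2 / 2)"
proof -
  interpret prob_space \<mu> using \<mu> by (simp add: prob_measure_Rd_def)
  have [measurable_cong]: "sets \<mu> = sets (borel_Rd d)" using \<mu> by (simp add: prob_measure_Rd_def)
  have [measurable]: "(\<lambda>x. x i) \<in> borel_measurable (borel_Rd d)" using i by simp
  have lip: "one_lipschitz d (\<lambda>x. x i)" "one_lipschitz d (\<lambda>x. - x i)"
    using abs_diff_le_edist[OF i] by (auto simp: one_lipschitz_def abs_minus_commute)
  have mean: "(\<integral>x. x i \<partial>\<mu>) = 0" using \<mu>(2) i by (simp add: centered_def)
  have "prob {x \<in> space \<mu>. r \<le> x i} \<le> exp (- \<beta> * r\<^sup>2 / 2)"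
    "prob {x \<in> space \<mu>. r \<le> - x i} \<le> exp (- \<beta> * r\<^sup>2 / 2)"
    using \<mu>(3) lip r mean unfolding gaussian_concentration_def by fastforce+
  moreover have "prob {x \<in> space \<mu>. r \<le> \<bar>x i\<bar>} \<le>
      prob {x \<in> space \<mu>. r \<le> x i} + prob {x \<in> space \<mu>. r \<le> - x i}"
  proof -
    have "prob {x \<in> space \<mu>. r \<le> \<bar>x i\<bar>} \<le>
        prob ({x \<in> space \<mu>. r \<le> x i} \<union> {x \<in> space \<mu>. r \<le> - x i})"
      by (rule finite_measure_mono) (auto simp: abs_if split: if_splits)
    also have "\<dots> \<le> prob {x \<in> space \<mu>. r \<le> x i} + prob {x \<in> space \<mu>. r \<le> - x i}"
      by (rule measure_Un_le) measurable
    finally show ?thesis .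
  qed
  ultimately show ?thesis by simp
qed

text \<open>The coordinates have second moment at most \<open>4 / \<beta>\<close>, so the squared
  norm has mean at most \<open>4 * d / \<beta>\<close>. The first moment is at most the root of the
  second.\<close>

lemma gaussian_concentration_mean_enorm:
  assumes d: "d \<ge> 1" and \<beta>: "\<beta> > 0"
    and \<mu>: "prob_measure_Rd d \<mu>" "centered d \<mu>" "gaussian_concentration d \<beta> \<mu>"
  shows "(\<integral>x. enorm d x \<partial>\<mu>) \<le> 2 * sqrt (real d / \<beta>)"
proof -
  interpret prob_space \<mu> using \<mu> by (simp add: prob_measure_Rd_def)
  have [measurable_cong]: "sets \<mu> = sets (borel_Rd d)" using \<mu> by (simp add: prob_measure_Rd_def)
  define \<rho> where "\<rho> = 2 * sqrt (real d / \<beta>)"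
  have \<rho>: "\<rho> > 0" "\<rho>\<^sup>2 = 4 * real d / \<beta>"
    using d \<beta> by (auto simp: \<rho>_def power_mult_distrib)
  have [measurable]: "(\<lambda>x. x i) \<in> borel_measurable (borel_Rd d)" if "i \<in> {..<d}" for i
    using that by simp
  have int: "integrable \<mu> (enorm d)"
    using \<mu>(3) one_lipschitz_enorm by (auto simp: gaussian_concentration_def)
  have sec: "(\<integral>\<^sup>+x. ennreal ((enorm d x)\<^sup>2) \<partial>\<mu>) \<le> ennreal (\<rho>\<^sup>2)"
  proof -
    have "(\<integral>\<^sup>+x. ennreal ((enorm d x)\<^sup>2) \<partial>\<mu>) = (\<integral>\<^sup>+x. (\<Sum>i<d. ennreal ((x i)\<^sup>2)) \<partial>\<mu>)"
      by (simp add: enorm_sq)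
    also have "\<dots> = (\<Sum>i<d. \<integral>\<^sup>+x. ennreal ((x i)\<^sup>2) \<partial>\<mu>)"
      by (rule nn_integral_sum) measurable
    also have "\<dots> \<le> (\<Sum>i<d. ennreal (4 / \<beta>))"
      by (intro sum_mono nn_integral_square_le_of_subgaussian_tail \<beta>
          gaussian_concentration_coordinate_tail[OF \<mu>]) auto
    also have "\<dots> = ennreal (\<rho>\<^sup>2)"
      using \<beta> by (simp add: \<rho> ennreal_of_nat_eq_real_of_nat flip: ennreal_mult)
    finally show ?thesis .
  qed
  have "ennreal (\<integral>x. enorm d x \<partial>\<mu>) = (\<integral>\<^sup>+x. ennreal (enorm d x) \<partial>\<mu>)"
    using int by (simp add: nn_integral_eq_integral)
  also have "\<dots> \<le> (\<integral>\<^sup>+x. ennreal (1 / (2 * \<rho>)) * ennreal ((enorm d x)\<^sup>2) + ennreal (\<rho> / 2) \<partial>\<mu>)"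
  proof (intro nn_integral_mono)
    fix x
    \<comment> \<open>AM-GM in place of Cauchy-Schwarz: with this \<open>\<rho>\<close>, the
      integral of the right side is at most \<open>\<rho> / 2 + \<rho> / 2\<close>.\<close>
    have "enorm d x \<le> 1 / (2 * \<rho>) * (enorm d x)\<^sup>2 + \<rho> / 2"
      using sum_squares_bound[of "enorm d x" \<rho>] \<rho>(1) by (simp add: field_simps power2_eq_square)
    then show "ennreal (enorm d x) \<le> ennreal (1 / (2 * \<rho>)) * ennreal ((enorm d x)\<^sup>2) + ennreal (\<rho> / 2)"
      using \<rho>(1) by (simp flip: ennreal_mult ennreal_plus)
  qed
  also have "\<dots> = ennreal (1 / (2 * \<rho>)) * (\<integral>\<^sup>+x. ennreal ((enorm d x)\<^sup>2) \<partial>\<mu>) + ennreal (\<rho> / 2)"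
    by (simp add: nn_integral_add nn_integral_cmult emeasure_space_1)
  also have "\<dots> \<le> ennreal (1 / (2 * \<rho>)) * ennreal (\<rho>\<^sup>2) + ennreal (\<rho> / 2)"
    by (intro add_mono mult_left_mono sec) auto
  also have "\<dots> = ennreal \<rho>"
    using \<rho>(1) by (simp add: power2_eq_square flip: ennreal_mult ennreal_plus)
  finally show ?thesis
    using \<rho>(1) by (simp flip: \<rho>_def)
qed

text \<open>Concentration of the norm at distance \<open>r = V / 2 - m\<close> above its mean
  \<open>m\<close> is compared with the lower tail bound. Both \<open>m\<close> and \<open>r\<close>
  are at most \<open>2 * b * Q\<close>, so \<open>V = 2 * (m + r)\<close> is at most
  \<open>8 * b * Q\<close>.\<close>

lemma brenier_map_bound_gaussian_concentration:
  assumes d: "d \<ge> 1" and \<beta>: "\<beta> > 0"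
    and \<mu>: "prob_measure_Rd d \<mu>" "centered d \<mu>" "gaussian_concentration d \<beta> \<mu>"
    and T: "brenier_map d \<mu> \<phi> T" and x: "x \<in> Rd d" "differentiable_Rd d \<phi> x"
  shows "enorm d (T x) \<le> 12 * \<beta> powr (- 1 / 2) * sqrt ((enorm d x)\<^sup>2 + 17 * real d)"
proof -
  interpret prob_space \<mu> using \<mu> by (simp add: prob_measure_Rd_def)
  have sets [measurable_cong]: "sets \<mu> = sets (borel_Rd d)" using \<mu> by (simp add: prob_measure_Rd_def)
  have space: "space \<mu> = Rd d" using sets_eq_imp_space_eq[OF sets] by (simp add: space_borel_Rd)
  define m where "m = (\<integral>x. enorm d x \<partial>\<mu>)"
  define V where "V = enorm d (T x)"
  define N where "N = (enorm d x)\<^sup>2"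
  define Q where "Q = sqrt (N + 17 * real d)"
  define b where "b = \<beta> powr (- 1 / 2)"
  have b: "b = 1 / sqrt \<beta>"
  proof -
    have "b = 1 / \<beta> powr (1 / 2)"
      unfolding b_def minus_divide_left[symmetric] by (rule powr_minus_divide)
    then show ?thesis using \<beta> by (simp add: powr_half_sqrt)
  qed
  have b0: "b > 0" using \<beta> by (simp add: b)
  have N: "N \<ge> 0" by (simp add: N_def)
  have Q: "Q \<ge> 0" "sqrt (real d) \<le> Q" using N by (auto simp: Q_def)
  have m: "m \<le> 2 * b * Q"
  proof -
    have "m \<le> 2 * sqrt (real d / \<beta>)"
      unfolding m_def by (rule gaussian_concentration_mean_enorm[OF d \<beta> \<mu>])
    also have "\<dots> = 2 * b * sqrt (real d)" by (simp add: b real_sqrt_divide)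
    also have "\<dots> \<le> 2 * b * Q" using Q b0 by (intro mult_left_mono) auto
    finally show ?thesis .
  qed
  have "V / 2 - m \<le> 2 * b * Q"
  proof (cases "V / 2 - m \<ge> 0")
    case True
    define r where "r = V / 2 - m"
    have r: "r \<ge> 0" using True by (simp add: r_def)
    \<comment> \<open>The factor 1/2 is at least \<open>exp (- 1)\<close>, which costs one more
      \<open>d\<close> because \<open>d \<ge> 1\<close>.\<close>
    have "exp (- (N + 19 * real d)) \<le> exp (- N - 18 * real d) / 2"
    proof -
      have "exp (- (N + 19 * real d)) \<le> exp (- N - 18 * real d) * exp (- 1)"
        using d unfolding mult_exp_exp by simp
      also have "\<dots> \<le> exp (- N - 18 * real d) * (1 / 2)"
        using exp_ge_add_one_self[of 1] by (intro mult_left_mono) (auto simp: exp_minus field_simps)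
      finally show ?thesis by simp
    qed
    also have "\<dots> \<le> prob {z \<in> Rd d. V / 2 \<le> enorm d z}"
      unfolding N_def V_def by (rule brenier_map_tail_lower_bound[OF d T x])
    also have "\<dots> = prob {z \<in> space \<mu>. m + r \<le> enorm d z}"
      by (simp add: r_def space)
    also have "\<dots> \<le> exp (- \<beta> * r\<^sup>2 / 2)"
      using \<mu>(3) one_lipschitz_enorm r unfolding gaussian_concentration_def m_def by blast
    finally have "\<beta> * r\<^sup>2 \<le> 2 * N + 38 * real d" by simp
    also have "\<dots> \<le> 4 * Q\<^sup>2" using N by (simp add: Q_def)
    finally have "r\<^sup>2 \<le> (2 * b * Q)\<^sup>2"
      using \<beta> by (simp add: b power_mult_distrib power_divide field_simps)
    moreover have "0 \<le> 2 * b * Q" using b0 Q by simp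
    ultimately have "r \<le> 2 * b * Q" by (rule power2_le_imp_le)
    then show ?thesis by (simp only: r_def)
  next
    case False
    have "0 \<le> 2 * b * Q" using b0 Q by simp
    with False show ?thesis by linarith
  qed
  with m have "V \<le> 8 * (b * Q)" by (simp add: mult.assoc)
  also have "\<dots> \<le> 12 * (b * Q)" using b0 Q by simp
  finally show ?thesis by (simp add: V_def b_def Q_def N_def mult.assoc)
qed

subsection \<open>Log-concave measures\<close>

locale log_concave_density =
  fixes d :: nat and f :: "(nat \<Rightarrow> real) \<Rightarrow> real"
  assumes f_measurable [measurable]: "f \<in> borel_measurable (lborel_Rd d)"
    and f_nonneg: "x \<in> Rd d \<Longrightarrow> 0 \<le> f x"
    and f_log_concave: "x \<in> Rd d \<Longrightarrow> y \<in> Rd d \<Longrightarrow> 0 < t \<Longrightarrow> t < 1 \<Longrightarrow>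
      f x powr (1 - t) * f y powr t \<le> f (segment_point d t x y)"
    and prob_space_density: "prob_space (density (lborel_Rd d) (\<lambda>x. ennreal (f x)))"
begin

lemma nn_integral_density_eq_1: "(\<integral>\<^sup>+x. ennreal (f x) \<partial>lborel_Rd d) = 1"
proof -
  interpret prob_space "density (lborel_Rd d) (\<lambda>x. ennreal (f x))" by (rule prob_space_density)
  have "(\<integral>\<^sup>+x. ennreal (f x) \<partial>lborel_Rd d) =
      (\<integral>\<^sup>+x. ennreal (f x) * indicator (space (lborel_Rd d)) x \<partial>lborel_Rd d)"
    by (intro nn_integral_cong) simp
  also have "\<dots> = emeasure (density (lborel_Rd d) (\<lambda>x. ennreal (f x))) (space (lborel_Rd d))"
    by (subst emeasure_density) auto
  finally show ?thesis using emeasure_space_1 by simp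
qed

text \<open>The integral \<open>I\<close> of the overview. It is extended-valued because its
  finiteness is itself a consequence of log-concavity.\<close>

definition sqrt_mass :: ennreal where
  "sqrt_mass = (\<integral>\<^sup>+x. ennreal (sqrt (f x)) \<partial>lborel_Rd d)"

text \<open>Log-concavity at the midpoint bounds \<open>sqrt (f w) * sqrt (f z)\<close> by the
  density at the midpoint of \<open>w\<close> and \<open>z\<close>. Integrating in \<open>z\<close>
  gives the Jacobian \<open>2 ^ d\<close> times the total mass 1.\<close>

lemma sqrt_mult_sqrt_mass_le:
  assumes w: "w \<in> Rd d"
  shows "ennreal (sqrt (f w)) * sqrt_mass \<le> ennreal (2 ^ d)"
proof -
  define g where "g z = ennreal (f (\<lambda>i\<in>{..<d}. w i / 2 + 1 / 2 * z i))" for z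
  have "ennreal (sqrt (f w)) * sqrt_mass = (\<integral>\<^sup>+z. ennreal (sqrt (f w)) * ennreal (sqrt (f z)) \<partial>lborel_Rd d)"
    unfolding sqrt_mass_def by (rule nn_integral_cmult[symmetric]) measurable
  also have "\<dots> \<le> (\<integral>\<^sup>+z. g z \<partial>lborel_Rd d)"
  proof (intro nn_integral_mono)
    fix z assume "z \<in> space (lborel_Rd d)"
    then have z: "z \<in> Rd d" by (simp add: space_lborel_Rd)
    have "segment_point d (1 / 2) w z = (\<lambda>i\<in>{..<d}. w i / 2 + 1 / 2 * z i)"
      by (auto simp: segment_point_def fun_eq_iff)
    then have "sqrt (f w) * sqrt (f z) \<le> f (\<lambda>i\<in>{..<d}. w i / 2 + 1 / 2 * z i)"
      using f_log_concave[OF w z, of "1 / 2"] f_nonneg[OF w] f_nonneg[OF z]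
      by (simp add: powr_half_sqrt)
    then show "ennreal (sqrt (f w)) * ennreal (sqrt (f z)) \<le> g z"
      using f_nonneg[OF w] f_nonneg[OF z] by (simp add: g_def ennreal_leI flip: ennreal_mult)
  qed
  also have "\<dots> = ennreal (2 ^ d)"
  proof -
    have "ennreal ((1 / 2) ^ d) * (\<integral>\<^sup>+z. g z \<partial>lborel_Rd d) = 1"
      unfolding g_def nn_integral_density_eq_1[symmetric]
      by (rule nn_integral_lborel_Rd_affine[symmetric]) auto
    then have "ennreal (2 ^ d) * (ennreal ((1 / 2) ^ d) * (\<integral>\<^sup>+z. g z \<partial>lborel_Rd d)) = ennreal (2 ^ d)"
      by simp
    moreover have "ennreal (2 ^ d) * ennreal ((1 / 2) ^ d) = 1"
      by (simp add: power_one_over flip: ennreal_mult)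
    ultimately show ?thesis by (simp flip: mult.assoc)
  qed
  finally show ?thesis .
qed

text \<open>Finite by the previous bound at a point of positive density; positive because the
  density is not almost everywhere 0. Later arguments cancel this factor.\<close>

lemma sqrt_mass_pos_finite: obtains J where "J > 0" "sqrt_mass = ennreal J"
proof -
  have "\<exists>w\<in>Rd d. f w > 0"
  proof (rule ccontr)
    assume "\<not> ?thesis"
    then have "(\<integral>\<^sup>+x. ennreal (f x) \<partial>lborel_Rd d) = (\<integral>\<^sup>+x. 0 \<partial>lborel_Rd d)"
      by (intro nn_integral_cong) (auto simp: space_lborel_Rd not_less ennreal_neg)
    then show False using nn_integral_density_eq_1 by simp
  qed
  then obtain w where w: "w \<in> Rd d" "f w > 0" by blast
  have "sqrt_mass \<noteq> \<infinity>"
  proof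
    assume "sqrt_mass = \<infinity>"
    then show False
      using sqrt_mult_sqrt_mass_le[OF w(1)] w(2) by (simp add: ennreal_mult_top top_unique)
  qed
  moreover have "sqrt_mass \<noteq> 0"
  proof
    assume "sqrt_mass = 0"
    then have "AE x in lborel_Rd d. ennreal (sqrt (f x)) = 0"
      unfolding sqrt_mass_def by (subst (asm) nn_integral_0_iff_AE) auto
    then have "AE x in lborel_Rd d. ennreal (f x) = 0"
      by eventually_elim (simp add: ennreal_eq_0_iff)
    then have "(\<integral>\<^sup>+x. ennreal (f x) \<partial>lborel_Rd d) = 0"
      by (subst nn_integral_0_iff_AE) auto
    then show False using nn_integral_density_eq_1 by simp
  qed
  ultimately show ?thesis
    using that by (cases sqrt_mass) (auto simp: zero_less_iff_neq_zero less_le)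
qed

text \<open>Otherwise the homothety \<open>w \<mapsto> (1 - \<tau>) w + \<tau> z\<close> with \<open>\<tau> = 1 / (2 s)\<close> would, at the cost
  of a constant factor only, carry the slab \<open>\<bar>\<langle>w, \<theta>\<rangle>\<bar> < 2\<close> (mass at least \<open>3/4\<close>) into a
  half-space \<open>\<langle>y, \<theta>\<rangle> \<ge> L\<close> of mass at most \<open>1 / L\<^sup>2\<close>; here \<open>\<theta> = z / \<bar>z\<bar>\<close>.\<close>

lemma enorm_less_of_density_large:
  assumes d: "d \<ge> 1"
    and cheb: "\<And>\<theta> L. enorm d \<theta> = 1 \<Longrightarrow> L > 0 \<Longrightarrow>
      measure (density (lborel_Rd d) (\<lambda>x. ennreal (f x))) {x \<in> Rd d. L \<le> \<bar>\<Sum>i<d. \<theta> i * x i\<bar>} \<le> 1 / L\<^sup>2"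
    and J: "J > 0" "sqrt_mass = ennreal J"
    and s: "s \<ge> real d" and a: "a \<ge> 0" and z: "z \<in> Rd d" and fz: "exp (- a * s) \<le> f z * J\<^sup>2"
  shows "enorm d z < (4 * exp ((a + 2) / 4) + 4) * s"
proof (rule ccontr)
  define \<mu> where "\<mu> = density (lborel_Rd d) (\<lambda>x. ennreal (f x))"
  interpret prob_space \<mu> unfolding \<mu>_def by (rule prob_space_density)
  have sets [measurable_cong]: "sets \<mu> = sets (borel_Rd d)" by (simp add: \<mu>_def sets_lborel_Rd)
  note [measurable_cong] = sets_lborel_Rd
  have space: "space \<mu> = Rd d" by (simp add: \<mu>_def space_lborel_Rd)
  \<comment> \<open>\<open>E\<close> is the loss of density under the homothety. \<open>L\<close>
    satisfies \<open>L\<^sup>2 = 4 * E\<close>, so the half-space has mass at most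
    \<open>1 / (4 * E)\<close>, less than the mass at least \<open>3 / (8 * E)\<close> carried into
    it.\<close>
  define L where "L = 2 * exp ((a + 2) / 4)"
  define E where "E = exp ((a + 2) / 2)"
  define V where "V = enorm d z"
  define \<tau> where "\<tau> = 1 / (2 * s)"
  define \<theta> where "\<theta> i = z i / V" for i
  have L: "L > 0" "L\<^sup>2 = 4 * E"
    by (auto simp: L_def E_def power_mult_distrib simp flip: exp_double)
  have E: "E > 0" by (simp add: E_def)
  have s1: "s \<ge> 1" using d s by linarith
  assume "\<not> enorm d z < (4 * exp ((a + 2) / 4) + 4) * s"
  \<comment> \<open>As \<open>\<tau> * s = 1 / 2\<close>, this makes \<open>\<tau> * V\<close> at
    least \<open>L + 2\<close>, which pushes every slab point, contributing at least -2, to level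
    \<open>L\<close> or beyond.\<close>
  then have V: "V \<ge> (2 * L + 4) * s" by (simp add: V_def L_def)
  then have V0: "V > 0" using L s1 by (smt (verit) mult_pos_pos)
  have \<tau>: "0 < \<tau>" "\<tau> < 1" using s1 by (auto simp: \<tau>_def)
  have V2: "V\<^sup>2 = (\<Sum>i<d. z i * z i)"
    unfolding V_def enorm_sq by (simp add: power2_eq_square)
  have \<theta>z: "(\<Sum>i<d. \<theta> i * z i) = V"
  proof -
    have "(\<Sum>i<d. \<theta> i * z i) = V\<^sup>2 / V"
      unfolding V2 by (simp add: \<theta>_def sum_divide_distrib)
    then show ?thesis using V0 by (simp add: power2_eq_square)
  qed
  have \<theta>1: "enorm d \<theta> = 1"
  proof -
    have "\<theta> = (\<lambda>i. inverse V * z i)"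
      by (simp add: \<theta>_def fun_eq_iff field_simps)
    then show ?thesis
      using enorm_scale[of "inverse V" d z] V0 by (simp flip: V_def)
  qed
  have [measurable]: "(\<lambda>x. \<Sum>i<d. \<theta> i * x i) \<in> borel_measurable (borel_Rd d)"
    by measurable
  define W where "W = {x \<in> Rd d. \<bar>\<Sum>i<d. \<theta> i * x i\<bar> < 2}"
  define H where "H = {x \<in> Rd d. L \<le> \<bar>\<Sum>i<d. \<theta> i * x i\<bar>}"
  have WH [measurable]: "W \<in> sets (borel_Rd d)" "H \<in> sets (borel_Rd d)"
    unfolding W_def H_def space_borel_Rd[symmetric] by measurable
  have H: "prob H \<le> 1 / L\<^sup>2"
    unfolding H_def \<mu>_def by (rule cheb[OF \<theta>1 L(1)])
  have W: "prob W \<ge> 3 / 4"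
  proof -
    have "W = space \<mu> - {x \<in> Rd d. 2 \<le> \<bar>\<Sum>i<d. \<theta> i * x i\<bar>}"
      by (auto simp: W_def space)
    moreover have "{x \<in> Rd d. 2 \<le> \<bar>\<Sum>i<d. \<theta> i * x i\<bar>} \<in> sets \<mu>"
      unfolding space[symmetric] by measurable
    moreover have "prob {x \<in> Rd d. 2 \<le> \<bar>\<Sum>i<d. \<theta> i * x i\<bar>} \<le> 1 / 2\<^sup>2"
      unfolding \<mu>_def by (rule cheb[OF \<theta>1]) simp
    ultimately show ?thesis by (simp add: prob_compl)
  qed
  \<comment> \<open>Since \<open>d * \<tau> \<le> 1 / 2\<close> by \<open>s \<ge> d\<close>,
    Bernoulli's inequality bounds the volume loss \<open>c ^ d\<close> from below independently of
    \<open>d\<close>.\<close>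
  define c where "c = 1 - \<tau>"
  have c: "0 < c" "1 / 2 \<le> c ^ d"
  proof -
    show "0 < c" using \<tau> by (simp add: c_def)
    have "1 / 2 \<le> 1 + real d * (- \<tau>)"
      using s s1 by (simp add: \<tau>_def field_simps)
    also have "\<dots> \<le> (1 + (- \<tau>)) ^ d"
      using \<tau> by (intro Bernoulli_inequality) simp
    finally show "1 / 2 \<le> c ^ d" by (simp add: c_def)
  qed
  have point: "segment_point d \<tau> w z \<in> H \<and> f w / E \<le> f (segment_point d \<tau> w z)" if w: "w \<in> W" for w
  proof
    have wR: "w \<in> Rd d" using w by (simp add: W_def)
    have "(\<Sum>i<d. \<theta> i * segment_point d \<tau> w z i) = (1 - \<tau>) * (\<Sum>i<d. \<theta> i * w i) + \<tau> * V"
      unfolding \<theta>z[symmetric] sum_distrib_left sum.distrib[symmetric]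
      by (intro sum.cong) (auto simp: segment_point_def algebra_simps)
    moreover have "\<tau> * V \<ge> L + 2"
      using V s1 by (simp add: \<tau>_def field_simps)
    moreover have "\<bar>(1 - \<tau>) * (\<Sum>i<d. \<theta> i * w i)\<bar> \<le> 1 * 2"
      unfolding abs_mult using \<tau> w by (intro mult_mono) (auto simp: W_def)
    ultimately show "segment_point d \<tau> w z \<in> H"
      by (auto simp: H_def)
    have fz0: "f z > 0"
      using fz J by (smt (verit) exp_gt_zero zero_less_mult_pos2 zero_less_power)
    have "sqrt (f w) * J \<le> 2 ^ d"
      using sqrt_mult_sqrt_mass_le[OF wR] J f_nonneg[OF wR] by (simp flip: ennreal_mult)
    then have "(sqrt (f w) * J)\<^sup>2 \<le> (2 ^ d)\<^sup>2"
      using J f_nonneg[OF wR] by (intro power_mono) auto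
    then have "f w * J\<^sup>2 \<le> (2 ^ d)\<^sup>2"
      using f_nonneg[OF wR] by (simp add: power_mult_distrib)
    also have "(2 ^ d)\<^sup>2 \<le> (exp (real d) :: real)\<^sup>2"
    proof -
      have "2 ^ d \<le> (exp 1 :: real) ^ d"
        using exp_ge_add_one_self[of 1] by (intro power_mono) auto
      then show ?thesis
        by (intro power_mono) (auto simp flip: exp_of_nat_mult)
    qed
    also have "\<dots> \<le> exp (2 * s)"
      using s by (simp flip: exp_double)
    also have "\<dots> = exp ((a + 2) * s) * exp (- a * s)"
      by (simp add: mult_exp_exp algebra_simps)
    also have "\<dots> \<le> exp ((a + 2) * s) * (f z * J\<^sup>2)"
      using fz by (intro mult_left_mono) auto
    finally have "f w * J\<^sup>2 \<le> (exp ((a + 2) * s) * f z) * J\<^sup>2"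
      by (simp add: mult.assoc)
    then have "f w \<le> exp ((a + 2) * s) * f z"
      using J by simp
    \<comment> \<open>The ratio of \<open>f w\<close> to \<open>f z\<close> can be exponentially
      large in \<open>s\<close>, but the power \<open>\<tau> = 1 / (2 * s)\<close> reduces it to the
      constant \<open>E\<close>.\<close>
    then have "f w powr \<tau> \<le> (exp ((a + 2) * s) * f z) powr \<tau>"
      using f_nonneg[OF wR] \<tau> by (intro powr_mono2) auto
    also have "\<dots> = exp ((a + 2) * s * \<tau>) * f z powr \<tau>"
      using fz0 by (simp add: powr_mult powr_def[of "exp _"] mult_ac)
    also have "(a + 2) * s * \<tau> = (a + 2) / 2"
      using s1 by (simp add: \<tau>_def)
    finally have 1: "f w powr \<tau> \<le> E * f z powr \<tau>" by (simp add: E_def)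
    \<comment> \<open>Also valid at \<open>f w = 0\<close>, as \<open>0 powr a = 0\<close>.\<close>
    have "f w = f w powr (1 - \<tau>) * f w powr \<tau>"
      using f_nonneg[OF wR] by (simp flip: powr_add)
    also have "\<dots> \<le> f w powr (1 - \<tau>) * (E * f z powr \<tau>)"
      using 1 by (intro mult_left_mono) auto
    also have "\<dots> = E * (f w powr (1 - \<tau>) * f z powr \<tau>)" by simp
    also have "\<dots> \<le> E * f (segment_point d \<tau> w z)"
      using f_log_concave[OF wR z \<tau>] E by (intro mult_left_mono) auto
    finally show "f w / E \<le> f (segment_point d \<tau> w z)"
      using E by (simp add: field_simps)
  qed
  have seg: "(\<lambda>i\<in>{..<d}. \<tau> * z i + c * w i) = segment_point d \<tau> w z" for w
    by (simp add: segment_point_def c_def add.commute)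
  have "ennreal (c ^ d * (prob W / E)) = ennreal (c ^ d) * (ennreal (1 / E) * emeasure \<mu> W)"
    using c E by (simp add: emeasure_eq_measure flip: ennreal_mult)
  also have "ennreal (1 / E) * emeasure \<mu> W =
      (\<integral>\<^sup>+w. ennreal (1 / E) * (ennreal (f w) * indicator W w) \<partial>lborel_Rd d)"
    unfolding \<mu>_def by (simp add: emeasure_density nn_integral_cmult)
  also have "\<dots> \<le> (\<integral>\<^sup>+w. ennreal (f (\<lambda>i\<in>{..<d}. \<tau> * z i + c * w i)) *
      indicator H (\<lambda>i\<in>{..<d}. \<tau> * z i + c * w i) \<partial>lborel_Rd d)"
    unfolding seg
  proof (intro nn_integral_mono)
    fix w
    show "ennreal (1 / E) * (ennreal (f w) * indicator W w) \<le>
        ennreal (f (segment_point d \<tau> w z)) * indicator H (segment_point d \<tau> w z)"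
    proof (cases "w \<in> W")
      case True
      then have "ennreal (1 / E) * ennreal (f w) = ennreal (f w / E)"
        using E f_nonneg[of w] by (simp add: W_def flip: ennreal_mult)
      then show ?thesis using point[OF True] True by (simp add: ennreal_leI)
    qed simp
  qed
  also have "ennreal (c ^ d) * \<dots> = (\<integral>\<^sup>+y. ennreal (f y) * indicator H y \<partial>lborel_Rd d)"
    by (rule nn_integral_lborel_Rd_affine[OF c(1), symmetric]) measurable
  also have "\<dots> = ennreal (prob H)"
    unfolding emeasure_eq_measure[symmetric] unfolding \<mu>_def by (simp add: emeasure_density)
  finally have "c ^ d * (prob W / E) \<le> prob H"
    by (simp add: mult_left_mono)
  moreover have "1 / 2 * (3 / 4 / E) \<le> c ^ d * (prob W / E)"
    using c W E by (intro mult_mono divide_right_mono) auto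
  ultimately have "1 / 2 * (3 / 4 / E) \<le> 1 / (4 * E)"
    using H L by simp
  then show False using E by (simp add: field_simps)
qed

text \<open>By contraposition of the previous lemma, \<open>sqrt (f z) * J\<close> is at most
  \<open>exp (- a * s / 2)\<close> far out. One factor \<open>sqrt (f z)\<close> is spent on this
  bound, the other integrates to at most \<open>J\<close>, which cancels.\<close>

lemma enorm_tail:
  assumes d: "d \<ge> 1"
    and cheb: "\<And>\<theta> L. enorm d \<theta> = 1 \<Longrightarrow> L > 0 \<Longrightarrow>
      measure (density (lborel_Rd d) (\<lambda>x. ennreal (f x))) {x \<in> Rd d. L \<le> \<bar>\<Sum>i<d. \<theta> i * x i\<bar>} \<le> 1 / L\<^sup>2"
    and s: "s \<ge> real d" and a: "a \<ge> 0"
  shows "measure (density (lborel_Rd d) (\<lambda>x. ennreal (f x)))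
      {z \<in> Rd d. (4 * exp ((a + 2) / 4) + 4) * s \<le> enorm d z} \<le> exp (- a * s / 2)"
proof -
  define \<mu> where "\<mu> = density (lborel_Rd d) (\<lambda>x. ennreal (f x))"
  interpret prob_space \<mu> unfolding \<mu>_def by (rule prob_space_density)
  note [measurable_cong] = sets_lborel_Rd
  define B where "B = {z \<in> Rd d. (4 * exp ((a + 2) / 4) + 4) * s \<le> enorm d z}"
  have [measurable]: "B \<in> sets (borel_Rd d)"
    unfolding B_def space_borel_Rd[symmetric] by measurable
  obtain J where J: "J > 0" "sqrt_mass = ennreal J" by (rule sqrt_mass_pos_finite)
  have point: "J * f z \<le> exp (- a * s / 2) * sqrt (f z)" if z: "z \<in> B" for z
  proof -
    have zR: "z \<in> Rd d" using z by (simp add: B_def)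
    have "f z * J\<^sup>2 \<le> exp (- a * s)"
      using enorm_less_of_density_large[OF d cheb J s a zR] z by (force simp: B_def)
    also have "\<dots> = (exp (- a * s / 2))\<^sup>2"
      by (simp flip: exp_double)
    finally have "(sqrt (f z) * J)\<^sup>2 \<le> (exp (- a * s / 2))\<^sup>2"
      using f_nonneg[OF zR] by (simp add: power_mult_distrib)
    then have "sqrt (f z) * J \<le> exp (- a * s / 2)"
      by (rule power2_le_imp_le) simp
    then have "sqrt (f z) * J * sqrt (f z) \<le> exp (- a * s / 2) * sqrt (f z)"
      using f_nonneg[OF zR] by (intro mult_right_mono) auto
    then show ?thesis
      using f_nonneg[OF zR] by (simp add: mult_ac flip: mult.assoc)
  qed
  have "ennreal (J * prob B) = ennreal J * emeasure \<mu> B"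
    using J by (simp add: emeasure_eq_measure ennreal_mult)
  also have "\<dots> = (\<integral>\<^sup>+z. ennreal J * (ennreal (f z) * indicator B z) \<partial>lborel_Rd d)"
    unfolding \<mu>_def by (simp add: emeasure_density nn_integral_cmult)
  also have "\<dots> \<le> (\<integral>\<^sup>+z. ennreal (exp (- a * s / 2)) * ennreal (sqrt (f z)) \<partial>lborel_Rd d)"
  proof (intro nn_integral_mono)
    fix z
    show "ennreal J * (ennreal (f z) * indicator B z) \<le> ennreal (exp (- a * s / 2)) * ennreal (sqrt (f z))"
    proof (cases "z \<in> B")
      case True
      then have "0 \<le> f z" using f_nonneg by (simp add: B_def)
      then show ?thesis
        using point[OF True] True J by (simp add: ennreal_leI flip: ennreal_mult)
    qed simp
  qed
  also have "\<dots> = ennreal (exp (- a * s / 2)) * sqrt_mass"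
    unfolding sqrt_mass_def by (rule nn_integral_cmult) measurable
  also have "\<dots> = ennreal (J * exp (- a * s / 2))"
    using J by (simp add: mult.commute flip: ennreal_mult)
  finally show ?thesis
    using J by (simp flip: \<mu>_def B_def)
qed

end

text \<open>Expanding the square and inserting the identity covariance gives the linear form the
  second moment \<open>(enorm d \<theta>)\<^sup>2 = 1\<close>. Mixed products are integrable because
  they are dominated by sums of squares.\<close>

lemma isotropic_Chebyshev:
  assumes \<mu>: "prob_measure_Rd d \<mu>" "centered d \<mu>" "isotropic d \<mu>"
    and \<theta>: "enorm d \<theta> = 1" and L: "L > 0"
  shows "measure \<mu> {x \<in> Rd d. L \<le> \<bar>\<Sum>i<d. \<theta> i * x i\<bar>} \<le> 1 / L\<^sup>2"
proof -
  interpret prob_space \<mu> using \<mu> by (simp add: prob_measure_Rd_def)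
  have sets [measurable_cong]: "sets \<mu> = sets (borel_Rd d)" using \<mu> by (simp add: prob_measure_Rd_def)
  have space: "space \<mu> = Rd d" using sets_eq_imp_space_eq[OF sets] by (simp add: space_borel_Rd)
  have [measurable]: "(\<lambda>x. \<Sum>i<d. \<theta> i * x i) \<in> borel_measurable (borel_Rd d)"
    by measurable
  have int: "integrable \<mu> (\<lambda>x. x i * x j)" if ij: "i < d" "j < d" for i j
  proof (rule Bochner_Integration.integrable_bound)
    have [measurable]: "(\<lambda>x. x i) \<in> borel_measurable (borel_Rd d)" "(\<lambda>x. x j) \<in> borel_measurable (borel_Rd d)"
      using ij by simp_all
    show "(\<lambda>x. x i * x j) \<in> borel_measurable \<mu>" by measurable
    show "integrable \<mu> (\<lambda>x. (x i)\<^sup>2 + (x j)\<^sup>2)"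
      using \<mu>(3) ij by (auto simp: isotropic_def)
    have "\<bar>u * v\<bar> \<le> u\<^sup>2 + v\<^sup>2" for u v :: real
    proof -
      have "2 * \<bar>u * v\<bar> \<le> u\<^sup>2 + v\<^sup>2"
        using sum_squares_bound[of "\<bar>u\<bar>" "\<bar>v\<bar>"] by (simp add: abs_mult)
      then show ?thesis by linarith
    qed
    then show "AE x in \<mu>. norm (x i * x j) \<le> norm ((x i)\<^sup>2 + (x j)\<^sup>2)"
      by simp
  qed
  have cov: "(\<integral>x. x i * x j \<partial>\<mu>) = (if i = j then 1 else 0)" if "i < d" "j < d" for i j
    using \<mu>(2,3) that by (simp add: isotropic_def covariance_def centered_def)
  have sq: "(\<Sum>i<d. \<theta> i * x i)\<^sup>2 = (\<Sum>i<d. \<Sum>j<d. \<theta> i * \<theta> j * (x i * x j))" for x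
    by (simp add: power2_eq_square sum_product mult_ac)
  have "integrable \<mu> (\<lambda>x. (\<Sum>i<d. \<theta> i * x i)\<^sup>2)"
    unfolding sq using int by (intro Bochner_Integration.integrable_sum integrable_mult_right) auto
  then have "prob {x \<in> space \<mu>. L \<le> \<bar>\<Sum>i<d. \<theta> i * x i\<bar>} \<le> (\<integral>x. (\<Sum>i<d. \<theta> i * x i)\<^sup>2 \<partial>\<mu>) / L\<^sup>2"
    using L by (intro second_moment_method) auto
  also have "(\<integral>x. (\<Sum>i<d. \<theta> i * x i)\<^sup>2 \<partial>\<mu>) = (\<Sum>i<d. \<Sum>j<d. \<theta> i * \<theta> j * (\<integral>x. x i * x j \<partial>\<mu>))"
  proof -
    have "(\<integral>x. (\<Sum>i<d. \<theta> i * x i)\<^sup>2 \<partial>\<mu>) = (\<Sum>i<d. (\<integral>x. (\<Sum>j<d. \<theta> i * \<theta> j * (x i * x j)) \<partial>\<mu>))"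
      unfolding sq using int
      by (intro Bochner_Integration.integral_sum Bochner_Integration.integrable_sum integrable_mult_right) auto
    also have "\<dots> = (\<Sum>i<d. \<Sum>j<d. (\<integral>x. \<theta> i * \<theta> j * (x i * x j) \<partial>\<mu>))"
      using int by (intro sum.cong refl Bochner_Integration.integral_sum integrable_mult_right) auto
    finally show ?thesis by simp
  qed
  also have "\<dots> = (\<Sum>i<d. \<Sum>j<d. if i = j then (\<theta> i)\<^sup>2 else 0)"
    by (intro sum.cong refl) (auto simp: cov power2_eq_square)
  also have "\<dots> = (enorm d \<theta>)\<^sup>2"
    by (simp add: enorm_sq)
  finally show ?thesis using \<theta> by (simp add: space)
qed

text \<open>Apply the tail bound with \<open>s = d + \<bar>x\<bar>\<^sup>2\<close> and
  \<open>a = 40\<close>. A larger \<open>T x\<close> would force the lower bound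
  \<open>exp (- \<bar>x\<bar>\<^sup>2 - 18 * d) / 2\<close> below \<open>exp (- 20 * s)\<close>. The
  leading factor 2 undoes the halving of the norm of \<open>T x\<close>.\<close>

lemma brenier_map_bound_log_concave:
  assumes d: "d \<ge> 1"
    and \<mu>: "prob_measure_Rd d \<mu>" "centered d \<mu>" "isotropic d \<mu>" "log_concave_measure d \<mu>"
    and T: "brenier_map d \<mu> \<phi> T" and x: "x \<in> Rd d" "differentiable_Rd d \<phi> x"
  shows "enorm d (T x) \<le> 2 * (4 * exp ((40 + 2) / 4) + 4) * (real d + (enorm d x)\<^sup>2)"
proof (rule ccontr)
  assume neg: "\<not> ?thesis"
  obtain f where f: "f \<in> borel_measurable (lborel_Rd d)" "\<forall>x\<in>Rd d. 0 \<le> f x"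
      "\<forall>x\<in>Rd d. \<forall>y\<in>Rd d. \<forall>t. 0 < t \<and> t < 1 \<longrightarrow>
           f x powr (1 - t) * f y powr t \<le> f (segment_point d t x y)"
      "\<mu> = density (lborel_Rd d) (\<lambda>x. ennreal (f x))"
    using \<mu>(4) unfolding log_concave_measure_def by blast
  interpret prob_space \<mu> using \<mu> by (simp add: prob_measure_Rd_def)
  have sets [measurable_cong]: "sets \<mu> = sets (borel_Rd d)" using \<mu> by (simp add: prob_measure_Rd_def)
  interpret log_concave_density d f
  proof (rule log_concave_density.intro)
    show "prob_space (density (lborel_Rd d) (\<lambda>x. ennreal (f x)))"
      using prob_space_axioms by (simp only: f(4))
    show "f \<in> borel_measurable (lborel_Rd d)" by (rule f(1))
  qed (simp_all only: f(2,3) simp_thms)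
  define s where "s = real d + (enorm d x)\<^sup>2"
  define A where "A K = {z \<in> Rd d. K \<le> enorm d z}" for K
  have A [measurable]: "A K \<in> sets \<mu>" for K
    unfolding A_def sets space_borel_Rd[symmetric] by measurable
  have "exp (- (enorm d x)\<^sup>2 - 18 * real d) / 2 \<le> prob (A (enorm d (T x) / 2))"
    unfolding A_def by (rule brenier_map_tail_lower_bound[OF d T x])
  also have "\<dots> \<le> prob (A ((4 * exp ((40 + 2) / 4) + 4) * s))"
  proof (intro finite_measure_mono A)
    have "2 * (4 * exp ((40 + 2) / 4) + 4) * s < enorm d (T x)"
      using neg by (simp add: s_def)
    then show "A (enorm d (T x) / 2) \<subseteq> A ((4 * exp ((40 + 2) / 4) + 4) * s)"
      unfolding A_def by (intro Collect_mono conj_mono impI) (simp_all add: algebra_simps)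
  qed
  also have "\<dots> \<le> exp (- 40 * s / 2)"
    unfolding A_def f(4)
    by (rule enorm_tail[OF d]) (use isotropic_Chebyshev[OF \<mu>(1-3)] in \<open>auto simp: s_def f(4)\<close>)
  \<comment> \<open>\<open>20 * s\<close> exceeds the exponent to beat by at least
    \<open>2 * d\<close>, more than the 1 spent on replacing 1/2 by
    \<open>exp (- 1)\<close>.\<close>
  also have "\<dots> < exp (- (enorm d x)\<^sup>2 - 18 * real d) * exp (- 1)"
  proof -
    have "real d \<ge> 1" "(enorm d x)\<^sup>2 \<ge> 0" using d by auto
    then have "- 40 * s / 2 < - (enorm d x)\<^sup>2 - 18 * real d + - 1"
      unfolding s_def by argo
    then show ?thesis unfolding mult_exp_exp by simp
  qed
  also have "\<dots> \<le> exp (- (enorm d x)\<^sup>2 - 18 * real d) * (1 / 2)"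
    using exp_ge_add_one_self[of 1] by (intro mult_left_mono) (auto simp: exp_minus field_simps)
  finally show False by simp
qed

theorem theorem1p1:
  shows "(\<exists>C>0. \<forall>d\<ge>1. \<forall>\<mu> \<phi> T.
            prob_measure_Rd d \<mu> \<and> centered d \<mu> \<and> isotropic d \<mu> \<and> log_concave_measure d \<mu> \<and>
            brenier_map d \<mu> \<phi> T \<longrightarrow>
            (\<forall>x\<in>Rd d. differentiable_Rd d \<phi> x \<longrightarrow>
               enorm d (T x) \<le> C * (real d + (enorm d x)\<^sup>2)))
       \<and> (\<forall>d\<ge>1. \<forall>\<beta>>0. \<forall>\<mu> \<phi> T.
            prob_measure_Rd d \<mu> \<and> centered d \<mu> \<and> gaussian_concentration d \<beta> \<mu> \<and>
            brenier_map d \<mu> \<phi> T \<longrightarrow>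
            (\<forall>x\<in>Rd d. differentiable_Rd d \<phi> x \<longrightarrow>
               enorm d (T x) \<le> 12 * \<beta> powr (- 1 / 2) * sqrt ((enorm d x)\<^sup>2 + 17 * real d)))"
proof (intro conjI)
  show "\<exists>C>0. \<forall>d\<ge>1. \<forall>\<mu> \<phi> T.
      prob_measure_Rd d \<mu> \<and> centered d \<mu> \<and> isotropic d \<mu> \<and> log_concave_measure d \<mu> \<and>
      brenier_map d \<mu> \<phi> T \<longrightarrow>
      (\<forall>x\<in>Rd d. differentiable_Rd d \<phi> x \<longrightarrow>
         enorm d (T x) \<le> C * (real d + (enorm d x)\<^sup>2))"
  proof (intro exI[of _ "2 * (4 * exp ((40 + 2) / 4) + 4)"] conjI)
    show "0 < 2 * (4 * exp ((40 + 2) / 4) + 4 :: real)"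
      by (simp add: add_pos_pos)
  qed (use brenier_map_bound_log_concave in blast)
qed (use brenier_map_bound_gaussian_concentration in blast)

end
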